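(* For every integer $n \ge 5$ there exists a fully resolvable strict Mitchell mixed doubles round robin tournament MMDRR$(2n)$.
   Context: A mixed doubles game is a match between two teams, each team consisting of one man and one woman; in a game $M_a F_b$ v $M_c F_d$, $M_a$ and $F_b$ are partners, $M_c$ and $F_d$ are partners, and each player of one team opposes each player of the other team. A strict Mitchell mixed doubles round robin tournament MMDRR$(N)$ is a schedule (set) of mixed doubles games for $N$ men and $N$ women in which every man and every woman partner exactly once and oppose exactly once, and every pair of players of the same sex oppose at least once (equivalently, each player opposes exactly one same-sex player twice and all other same-sex players once). A schedule is resolvable into rounds if its games are partitioned into rounds such that each player plays in at most one game per round. For $N$ even, a round is full if it involves all $2N$ players (for $N$ odd, if it involves all but 2 players); otherwise it is short. The tournament is fully resolvable if its games can be partitioned into rounds with at most one short round. *)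

theory Defs
  imports Main "HOL-Library.Disjoint_Sets"
begin

text \<open>Players: men M_0..M_{N-1} and women F_0..F_{N-1}, indexed by naturals below N.
A team is a pair (a, b) meaning man M_a partnered with woman F_b.
A game M_a F_b v M_c F_d is the unordered pair of teams {(a,b),(c,d)},
where the two teams have different men and different women.\<close>

type_synonym team = "nat \<times> nat"
type_synonym game = "team set"

definition is_game :: "nat \<Rightarrow> game \<Rightarrow> bool" where
  "is_game N g \<longleftrightarrow> (\<exists>a b c d. g = {(a, b), (c, d)} \<and> a \<noteq> c \<and> b \<noteq> d
                         \<and> a < N \<and> b < N \<and> c < N \<and> d < N)"

definition man_plays :: "game \<Rightarrow> nat \<Rightarrow> bool" where
  "man_plays g a \<longleftrightarrow> (\<exists>x. (a, x) \<in> g)"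

definition woman_plays :: "game \<Rightarrow> nat \<Rightarrow> bool" where
  "woman_plays g b \<longleftrightarrow> (\<exists>x. (x, b) \<in> g)"

definition partners :: "game \<Rightarrow> nat \<Rightarrow> nat \<Rightarrow> bool" where
  "partners g a b \<longleftrightarrow> (a, b) \<in> g"

definition oppose_mw :: "game \<Rightarrow> nat \<Rightarrow> nat \<Rightarrow> bool" where
  "oppose_mw g a b \<longleftrightarrow> (\<exists>x y. (a, x) \<in> g \<and> (y, b) \<in> g \<and> (a, x) \<noteq> (y, b))"

text \<open>Two distinct men oppose in g (they necessarily lie on different teams).\<close>
definition oppose_mm :: "game \<Rightarrow> nat \<Rightarrow> nat \<Rightarrow> bool" where
  "oppose_mm g a c \<longleftrightarrow> a \<noteq> c \<and> man_plays g a \<and> man_plays g c"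

definition oppose_ww :: "game \<Rightarrow> nat \<Rightarrow> nat \<Rightarrow> bool" where
  "oppose_ww g b d \<longleftrightarrow> b \<noteq> d \<and> woman_plays g b \<and> woman_plays g d"

definition strict_MMDRR :: "nat \<Rightarrow> game set \<Rightarrow> bool" where
  "strict_MMDRR N S \<longleftrightarrow>
     finite S \<and> (\<forall>g\<in>S. is_game N g) \<and>
     (\<forall>a<N. \<forall>b<N. card {g\<in>S. partners g a b} = 1) \<and>
     (\<forall>a<N. \<forall>b<N. card {g\<in>S. oppose_mw g a b} = 1) \<and>
     (\<forall>a<N. \<forall>c<N. a \<noteq> c \<longrightarrow> (\<exists>g\<in>S. oppose_mm g a c)) \<and>
     (\<forall>b<N. \<forall>d<N. b \<noteq> d \<longrightarrow> (\<exists>g\<in>S. oppose_ww g b d))"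

definition is_round :: "game set \<Rightarrow> bool" where
  "is_round R \<longleftrightarrow> (\<forall>g\<in>R. \<forall>h\<in>R. g \<noteq> h \<longrightarrow>
      (\<forall>a. \<not> (man_plays g a \<and> man_plays h a)) \<and>
      (\<forall>b. \<not> (woman_plays g b \<and> woman_plays h b)))"

definition players_in :: "nat \<Rightarrow> game set \<Rightarrow> nat" where
  "players_in N R = card {a. a < N \<and> (\<exists>g\<in>R. man_plays g a)}
                  + card {b. b < N \<and> (\<exists>g\<in>R. woman_plays g b)}"

definition full_round :: "nat \<Rightarrow> game set \<Rightarrow> bool" where
  "full_round N R \<longleftrightarrow> (if even N then players_in N R = 2 * N
                         else players_in N R = 2 * N - 2)"

definition fully_resolvable :: "nat \<Rightarrow> game set \<Rightarrow> bool" where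
  "fully_resolvable N S \<longleftrightarrow>
     (\<exists>P. partition_on S P \<and> (\<forall>R\<in>P. is_round R) \<and>
          card {R\<in>P. \<not> full_round N R} \<le> 1)"

end

theory Submission
  imports Defs "HOL-Number_Theory.Cong" "HOL-Library.Code_Binary_Nat"
begin

text \<open>
  A game is the list [man, woman, man', woman', round], recorded for both orders of its teams, so that
  a schedule becomes a set of five-entry rows: each pair of values occurs exactly once in any two
  columns, except that a pair of distinct players of the same sex only has to occur at least once.
  A frame is such an array missing exactly the pairs of points that lie in a common hole; it becomes a
  schedule as soon as every hole carries one. Truncating the transversal design with coordinates
  \<open>x\<close>, \<open>y\<close>, \<open>x + y\<close>, \<open>2x + y\<close>, ... modulo \<open>m\<close>, doubling its points and putting a
  frame with holes of size 2 on each block of size 5 to 9 gives a frame whose holes are the doubled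
  groups. So schedules on \<open>2m\<close> and \<open>2w\<close> points give one on \<open>10m + 2w\<close> points, which settles large
  \<open>n\<close> by induction. For the remaining small \<open>n\<close> the frames are developed
  from base games, found by computer search, under a cyclic group: the differences in each pair of
  columns must all be distinct.
\<close>

text \<open>Rounds carry the same labels as the players, so a schedule on \<open>N\<close> points
  has exactly \<open>N\<close> rounds, each of them full: the tournament obtained has no short
  round. A player has \<open>N\<close> games but only \<open>N - 1\<close> possible opponents of the
  same sex, so same-sex pairs cannot all be met exactly once. Holes of size 2 absorb this defect:
  across holes every pair of columns, same-sex ones included, is met exactly once, and the two-point
  schedule that fills such a hole repeats just the pair inside it. With \<open>g ! 0\<close> and
  \<open>g ! 2\<close> as row and column and \<open>g ! 1\<close> as entry, a frame is a holey
  self-orthogonal Latin square, and \<open>g ! 4\<close> is its symmetric orthogonal mate. No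
  schedule for \<open>n = 2, 3, 4\<close> enters, so before doubling the truncated groups have 0, 1
  or at least 5 points. This gap, together with the coprimality that the linear transversal designs
  demand of \<open>m\<close>, decides which orders the recursion leaves to direct
  constructions.\<close>

definition swap_teams :: "'a list \<Rightarrow> 'a list" where
  "swap_teams g = [g ! 2, g ! 3, g ! 0, g ! 1, g ! 4]"

definition same_sex :: "nat \<Rightarrow> nat \<Rightarrow> bool" where
  "same_sex i j \<longleftrightarrow> {i, j} = {0, 2} \<or> {i, j} = {1, 3}"

text \<open>The mixed clause includes \<open>x = y\<close>, because man \<open>x\<close>, woman
  \<open>x\<close> and round \<open>x\<close> are different objects. For columns 0 and 4, or 1 and
  4, it says that every player has exactly one game in every round.\<close>

definition schedule :: "'a set \<Rightarrow> 'a list set \<Rightarrow> bool" where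
  "schedule X G \<longleftrightarrow>
     (\<forall>g\<in>G. length g = 5 \<and> set g \<subseteq> X \<and> g ! 0 \<noteq> g ! 2 \<and> g ! 1 \<noteq> g ! 3 \<and> swap_teams g \<in> G) \<and>
     (\<forall>i<5. \<forall>j<5. i \<noteq> j \<longrightarrow> (\<forall>x\<in>X. \<forall>y\<in>X.
        if same_sex i j then x \<noteq> y \<longrightarrow> (\<exists>g\<in>G. g ! i = x \<and> g ! j = y)
        else (\<exists>!g. g \<in> G \<and> g ! i = x \<and> g ! j = y)))"

text \<open>The columns of the same sex get no special treatment here. Holes are given by a
  labelling, of which only the induced partition matters.\<close>

definition frame :: "'a set \<Rightarrow> ('a \<Rightarrow> 'h) \<Rightarrow> 'a list set \<Rightarrow> bool" where
  "frame X h G \<longleftrightarrow>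
     (\<forall>g\<in>G. length g = 5 \<and> set g \<subseteq> X \<and>
        (\<forall>i<5. \<forall>j<5. i \<noteq> j \<longrightarrow> h (g ! i) \<noteq> h (g ! j)) \<and> swap_teams g \<in> G) \<and>
     (\<forall>i<5. \<forall>j<5. i \<noteq> j \<longrightarrow> (\<forall>x\<in>X. \<forall>y\<in>X. h x \<noteq> h y \<longrightarrow>
        (\<exists>!g. g \<in> G \<and> g ! i = x \<and> g ! j = y)))"

section \<open>Access rules for schedules and frames\<close>

lemma same_sex_sym: "same_sex i j \<longleftrightarrow> same_sex j i"
  by (simp add: same_sex_def insert_commute)

lemma same_sex_cases:
  "same_sex i j \<longleftrightarrow> (i = 0 \<and> j = 2) \<or> (i = 2 \<and> j = 0) \<or> (i = 1 \<and> j = 3) \<or> (i = 3 \<and> j = 1)"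
  by (auto simp: same_sex_def doubleton_eq_iff)

lemma swap_teams_map: "length g = 5 \<Longrightarrow> swap_teams (map f g) = map f (swap_teams g)"
  by (simp add: swap_teams_def)

lemma scheduleD:
  assumes "schedule X G" "g \<in> G"
  shows "length g = 5" "\<And>i. i < 5 \<Longrightarrow> g ! i \<in> X" "g ! 0 \<noteq> g ! 2" "g ! 1 \<noteq> g ! 3" "swap_teams g \<in> G"
    "set g \<subseteq> X"
proof -
  show *: "length g = 5" "g ! 0 \<noteq> g ! 2" "g ! 1 \<noteq> g ! 3" "swap_teams g \<in> G" "set g \<subseteq> X"
    using assms unfolding schedule_def by blast+
  show "g ! i \<in> X" if "i < 5" for i using *(1,5) that by (metis nth_mem subsetD)
qed

lemma schedule_ex1:
  assumes "schedule X G" "i < 5" "j < 5" "i \<noteq> j" "\<not> same_sex i j" "x \<in> X" "y \<in> X"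
  shows "\<exists>!g. g \<in> G \<and> g ! i = x \<and> g ! j = y"
proof -
  have "if same_sex i j then x \<noteq> y \<longrightarrow> (\<exists>g\<in>G. g ! i = x \<and> g ! j = y)
        else (\<exists>!g. g \<in> G \<and> g ! i = x \<and> g ! j = y)"
    using conjunct2[OF assms(1)[unfolded schedule_def]] assms(2-4,6,7) by blast
  then show ?thesis using assms(5) by (simp only: if_False)
qed

lemma schedule_ex:
  assumes "schedule X G" "i < 5" "j < 5" "i \<noteq> j" "x \<in> X" "y \<in> X" "x \<noteq> y"
  shows "\<exists>g\<in>G. g ! i = x \<and> g ! j = y"
proof -
  have "if same_sex i j then x \<noteq> y \<longrightarrow> (\<exists>g\<in>G. g ! i = x \<and> g ! j = y)
        else (\<exists>!g. g \<in> G \<and> g ! i = x \<and> g ! j = y)"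
    using conjunct2[OF assms(1)[unfolded schedule_def]] assms(2-6) by blast
  then show ?thesis using assms(7) by (auto split: if_splits)
qed

lemma frameD:
  assumes "frame X h G" "g \<in> G"
  shows "length g = 5" "\<And>i. i < 5 \<Longrightarrow> g ! i \<in> X" "swap_teams g \<in> G"
    "\<And>i j. i < 5 \<Longrightarrow> j < 5 \<Longrightarrow> i \<noteq> j \<Longrightarrow> h (g ! i) \<noteq> h (g ! j)" "set g \<subseteq> X"
proof -
  show *: "length g = 5" "swap_teams g \<in> G" "set g \<subseteq> X"
    "\<And>i j. i < 5 \<Longrightarrow> j < 5 \<Longrightarrow> i \<noteq> j \<Longrightarrow> h (g ! i) \<noteq> h (g ! j)"
    using assms unfolding frame_def by blast+
  show "g ! i \<in> X" if "i < 5" for i using *(1,3) that by (metis nth_mem subsetD)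
qed

lemma frame_ex1:
  assumes "frame X h G" "i < 5" "j < 5" "i \<noteq> j" "x \<in> X" "y \<in> X" "h x \<noteq> h y"
  shows "\<exists>!g. g \<in> G \<and> g ! i = x \<and> g ! j = y"
  using conjunct2[OF assms(1)[unfolded frame_def]] assms(2-7) by blast

lemma scheduleI:
  assumes "\<And>g. g \<in> G \<Longrightarrow> length g = 5 \<and> set g \<subseteq> X \<and> g ! 0 \<noteq> g ! 2 \<and> g ! 1 \<noteq> g ! 3 \<and> swap_teams g \<in> G"
    and "\<And>i j x y. i < 5 \<Longrightarrow> j < 5 \<Longrightarrow> i \<noteq> j \<Longrightarrow> same_sex i j \<Longrightarrow> x \<in> X \<Longrightarrow> y \<in> X \<Longrightarrow> x \<noteq> y \<Longrightarrow>
      \<exists>g\<in>G. g ! i = x \<and> g ! j = y"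
    and "\<And>i j x y. i < 5 \<Longrightarrow> j < 5 \<Longrightarrow> i \<noteq> j \<Longrightarrow> \<not> same_sex i j \<Longrightarrow> x \<in> X \<Longrightarrow> y \<in> X \<Longrightarrow>
      \<exists>!g. g \<in> G \<and> g ! i = x \<and> g ! j = y"
  shows "schedule X G"
  unfolding schedule_def
proof (intro conjI ballI allI impI)
  fix i j x y assume *: "i < (5::nat)" "j < (5::nat)" "i \<noteq> j" "x \<in> X" "y \<in> X"
  show "if same_sex i j then x \<noteq> y \<longrightarrow> (\<exists>g\<in>G. g ! i = x \<and> g ! j = y)
        else (\<exists>!g. g \<in> G \<and> g ! i = x \<and> g ! j = y)"
    using assms(2)[OF *(1-3) _ *(4,5)] assms(3)[OF *(1-3) _ *(4,5)] by (simp only: split: if_split) blast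
qed (use assms(1) in blast)+

lemma frameI:
  assumes "\<And>g. g \<in> G \<Longrightarrow> length g = 5 \<and> set g \<subseteq> X \<and> swap_teams g \<in> G"
    and "\<And>g i j. g \<in> G \<Longrightarrow> i < 5 \<Longrightarrow> j < 5 \<Longrightarrow> i \<noteq> j \<Longrightarrow> h (g ! i) \<noteq> h (g ! j)"
    and "\<And>i j x y. i < 5 \<Longrightarrow> j < 5 \<Longrightarrow> i \<noteq> j \<Longrightarrow> x \<in> X \<Longrightarrow> y \<in> X \<Longrightarrow> h x \<noteq> h y \<Longrightarrow>
      \<exists>!g. g \<in> G \<and> g ! i = x \<and> g ! j = y"
  shows "frame X h G"
  unfolding frame_def
  by (intro conjI ballI allI impI)
    (use assms(1) in blast, use assms(1) in blast, (rule assms(2); assumption),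
      use assms(1) in blast, (rule assms(3); assumption))

section \<open>Relabelling of points and filling of holes\<close>

lemma ex1_image:
  assumes inj: "inj_on f X" and G: "\<And>g. g \<in> G \<Longrightarrow> length g = 5 \<and> set g \<subseteq> X"
    and ij: "i < 5" "j < 5" and xy: "x \<in> X" "y \<in> X"
    and ex: "\<exists>!g. g \<in> G \<and> g ! i = x \<and> g ! j = y"
  shows "\<exists>!g. g \<in> map f ` G \<and> g ! i = f x \<and> g ! j = f y"
proof -
  obtain g where g: "g \<in> G" "g ! i = x" "g ! j = y" using ex by blast
  show ?thesis
  proof (rule ex1I[of _ "map f g"])
    show "map f g \<in> map f ` G \<and> map f g ! i = f x \<and> map f g ! j = f y"
      using g G ij by auto
  next
    fix g' assume g': "g' \<in> map f ` G \<and> g' ! i = f x \<and> g' ! j = f y"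
    then obtain g0 where g0: "g0 \<in> G" "g' = map f g0" by auto
    then have l: "length g0 = 5" "set g0 \<subseteq> X" using G by auto
    then have "f (g0 ! i) = f x" "f (g0 ! j) = f y" "g0 ! i \<in> X" "g0 ! j \<in> X"
      using g' g0 ij by auto
    then have "g0 ! i = x" "g0 ! j = y" using inj xy by (auto dest: inj_onD)
    then show "g' = map f g" using ex g g0 by blast
  qed
qed

lemma schedule_image:
  assumes s: "schedule X G" and inj: "inj_on f X"
  shows "schedule (f ` X) (map f ` G)"
proof -
  note D = scheduleD[OF s]
  have G: "\<And>g. g \<in> G \<Longrightarrow> length g = 5 \<and> set g \<subseteq> X" using D by auto
  have 1: "length g = 5 \<and> set g \<subseteq> f ` X \<and> g ! 0 \<noteq> g ! 2 \<and> g ! 1 \<noteq> g ! 3 \<and> swap_teams g \<in> map f ` G"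
    if "g \<in> map f ` G" for g
  proof -
    from that obtain g0 where g0: "g0 \<in> G" "g = map f g0" by auto
    have "g0 ! 0 \<in> X" "g0 ! 1 \<in> X" "g0 ! 2 \<in> X" "g0 ! 3 \<in> X" using D(2)[OF g0(1)] by auto
    then have "g ! 0 \<noteq> g ! 2" "g ! 1 \<noteq> g ! 3" using g0 D(1,3,4)[OF g0(1)] inj by (auto dest: inj_onD)
    then show ?thesis using g0 D(1,5,6)[OF g0(1)] by (auto simp: swap_teams_map)
  qed
  have 2: "\<exists>g\<in>map f ` G. g ! i = x \<and> g ! j = y"
    if ij: "i < 5" "j < 5" "i \<noteq> j" and fxy: "x \<in> f ` X" "y \<in> f ` X" "x \<noteq> y" for i j x y
  proof -
    from fxy obtain x0 y0 where xy: "x0 \<in> X" "y0 \<in> X" "x = f x0" "y = f y0" by auto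
    then obtain g where g: "g \<in> G" "g ! i = x0" "g ! j = y0"
      using schedule_ex[OF s ij, of x0 y0] \<open>x \<noteq> y\<close> by auto
    show ?thesis by (rule bexI[of _ "map f g"]) (use g D(1)[OF g(1)] ij xy in auto)
  qed
  have 3: "\<exists>!g. g \<in> map f ` G \<and> g ! i = x \<and> g ! j = y"
    if "i < 5" "j < 5" "i \<noteq> j" "\<not> same_sex i j" "x \<in> f ` X" "y \<in> f ` X" for i j x y
  proof -
    from that obtain x0 y0 where xy: "x0 \<in> X" "y0 \<in> X" "x = f x0" "y = f y0" by auto
    show ?thesis unfolding xy(3,4)
      by (rule ex1_image[OF inj G that(1,2) xy(1,2) schedule_ex1[OF s that(1-4) xy(1,2)]])
  qed
  show ?thesis by (rule scheduleI) ((rule 1; assumption), (rule 2; assumption), (rule 3; assumption))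
qed

lemma frame_image:
  assumes s: "frame X h G" and inj: "inj_on f X"
    and h: "\<And>x y. x \<in> X \<Longrightarrow> y \<in> X \<Longrightarrow> h' (f x) = h' (f y) \<longleftrightarrow> h x = h y"
  shows "frame (f ` X) h' (map f ` G)"
proof -
  note D = frameD[OF s]
  have G: "\<And>g. g \<in> G \<Longrightarrow> length g = 5 \<and> set g \<subseteq> X" using D by auto
  have 1: "length g = 5 \<and> set g \<subseteq> f ` X \<and> (\<forall>i<5. \<forall>j<5. i \<noteq> j \<longrightarrow> h' (g ! i) \<noteq> h' (g ! j)) \<and>
      swap_teams g \<in> map f ` G" if "g \<in> map f ` G" for g
  proof -
    from that obtain g0 where g0: "g0 \<in> G" "g = map f g0" by auto
    have "h' (g ! i) \<noteq> h' (g ! j)" if "i < 5" "j < 5" "i \<noteq> j" for i j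
      using g0 D(1)[OF g0(1)] D(2)[OF g0(1)] D(4)[OF g0(1)] that h by auto
    then show ?thesis using g0 D(1,3,5)[OF g0(1)] by (auto simp: swap_teams_map)
  qed
  have 2: "\<exists>!g. g \<in> map f ` G \<and> g ! i = x \<and> g ! j = y"
    if "i < 5" "j < 5" "i \<noteq> j" "x \<in> f ` X" "y \<in> f ` X" "h' x \<noteq> h' y" for i j x y
  proof -
    from that obtain x0 y0 where xy: "x0 \<in> X" "y0 \<in> X" "x = f x0" "y = f y0" by auto
    then have "h x0 \<noteq> h y0" using that(6) h by metis
    then show ?thesis unfolding xy(3,4)
      by (intro ex1_image[OF inj G that(1,2) xy(1,2) frame_ex1[OF s that(1-3) xy(1,2)]])
  qed
  show ?thesis by (rule frameI) (use 1 in blast, use 1 in blast, (rule 2; assumption))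
qed

text \<open>A row of the frame has its entries in five different holes, a row of a filling has all
  of them in one. Two entries therefore reveal which array a row comes from, and uniqueness in each
  array gives uniqueness in the union.\<close>

lemma schedule_fill_holes:
  assumes F: "frame X h F" and R: "\<And>c. c \<in> h ` X \<Longrightarrow> \<exists>G. schedule {x \<in> X. h x = c} G"
  shows "\<exists>G. schedule X G"
proof -
  obtain R where R: "\<And>c. c \<in> h ` X \<Longrightarrow> schedule {x \<in> X. h x = c} (R c)"
    using R by metis
  define G where "G = F \<union> (\<Union>c \<in> h ` X. R c)"
  note DF = frameD[OF F]
  have DR: "length g = 5" "\<And>i. i < 5 \<Longrightarrow> g ! i \<in> X \<and> h (g ! i) = c" "g ! 0 \<noteq> g ! 2"
    "g ! 1 \<noteq> g ! 3" "swap_teams g \<in> R c" "set g \<subseteq> X" if "c \<in> h ` X" "g \<in> R c" for c g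
    using scheduleD[OF R[OF that(1)] that(2)] by auto
  have 1: "length g = 5 \<and> set g \<subseteq> X \<and> g ! 0 \<noteq> g ! 2 \<and> g ! 1 \<noteq> g ! 3 \<and> swap_teams g \<in> G"
    if g: "g \<in> G" for g
  proof (cases "g \<in> F")
    case True
    have "h (g ! 0) \<noteq> h (g ! 2)" "h (g ! 1) \<noteq> h (g ! 3)" using DF(4)[OF True] by auto
    then show ?thesis using DF(1,3,5)[OF True] by (auto simp: G_def)
  next
    case False
    then obtain c where c: "c \<in> h ` X" "g \<in> R c" using g unfolding G_def by blast
    then show ?thesis using DR[OF c] unfolding G_def by blast
  qed
  have diff: "g \<in> F" if "g \<in> G" "h (g ! i) \<noteq> h (g ! j)" "i < 5" "j < 5" for g i j
  proof (rule ccontr)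
    assume "g \<notin> F"
    then obtain c where c: "c \<in> h ` X" "g \<in> R c" using \<open>g \<in> G\<close> unfolding G_def by blast
    show False using DR(2)[OF c, of i] DR(2)[OF c, of j] that by simp
  qed
  have same: "g \<in> R (h (g ! i))" if g: "g \<in> G" "h (g ! i) = h (g ! j)" "i < 5" "j < 5" "i \<noteq> j" for g i j
  proof -
    have "g \<notin> F" using DF(4)[of g i j] g by blast
    then obtain c where c: "c \<in> h ` X" "g \<in> R c" using g(1) unfolding G_def by blast
    show ?thesis using DR(2)[OF c g(3)] c(2) by simp
  qed
  have "schedule X G"
  proof (rule scheduleI)
    fix i j :: nat and x y assume ij: "i < 5" "j < 5" "i \<noteq> j" and ns: "\<not> same_sex i j" and x: "x \<in> X" and y: "y \<in> X"
    show "\<exists>!g. g \<in> G \<and> g ! i = x \<and> g ! j = y"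
    proof (cases "h x = h y")
      case False
      have "\<exists>!g. g \<in> F \<and> g ! i = x \<and> g ! j = y" using frame_ex1[OF F ij x y False] .
      moreover have "g \<in> G \<and> g ! i = x \<and> g ! j = y \<longleftrightarrow> g \<in> F \<and> g ! i = x \<and> g ! j = y" for g
        using diff[of g i j] ij False unfolding G_def by blast
      ultimately show ?thesis by simp
    next
      case True
      define c where "c = h x"
      have c: "c \<in> h ` X" "x \<in> {x \<in> X. h x = c}" "y \<in> {x \<in> X. h x = c}" using x y True c_def by auto
      have "R c \<subseteq> G" using c(1) unfolding G_def by blast
      then have "g \<in> G \<and> g ! i = x \<and> g ! j = y \<longleftrightarrow> g \<in> R c \<and> g ! i = x \<and> g ! j = y" for g
        using same[of g i j] ij True c_def by blast
      then show ?thesis using schedule_ex1[OF R[OF c(1)] ij ns c(2,3)] by simp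
    qed
  next
    fix i j :: nat and x y assume ij: "i < 5" "j < 5" "i \<noteq> j" and x: "x \<in> X" and y: "y \<in> X" and xy: "x \<noteq> y"
    show "\<exists>g\<in>G. g ! i = x \<and> g ! j = y"
    proof (cases "h x = h y")
      case False
      then show ?thesis using frame_ex1[OF F ij x y False] unfolding G_def by blast
    next
      case True
      then have "h x \<in> h ` X" "x \<in> {z \<in> X. h z = h x}" "y \<in> {z \<in> X. h z = h x}" using x y by auto
      then show ?thesis using schedule_ex[OF R ij _ _ xy] unfolding G_def by blast
    qed
  qed (fact 1)
  then show ?thesis by blast
qed

section \<open>Wilson's fundamental construction\<close>

text \<open>The group divisible design with groups \<open>grp\<close> and blocks \<open>Bs\<close>
  gets weight \<open>E\<close>. A block meets each group at most once, so entries lying over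
  different points of a block lie over different groups; conversely two points of different groups
  select a single block, and then the frame on it selects a single row.\<close>

lemma frame_from_blocks:
  fixes P :: "'p set" and grp :: "'p \<Rightarrow> 'g" and Bs :: "'p set set"
  assumes sub: "\<And>B. B \<in> Bs \<Longrightarrow> B \<subseteq> P" and inj: "\<And>B. B \<in> Bs \<Longrightarrow> inj_on grp B"
    and lin: "\<And>p q. p \<in> P \<Longrightarrow> q \<in> P \<Longrightarrow> grp p \<noteq> grp q \<Longrightarrow> \<exists>!B. B \<in> Bs \<and> p \<in> B \<and> q \<in> B"
    and fr: "\<And>B. B \<in> Bs \<Longrightarrow> \<exists>F. frame (B \<times> E) fst F"
  shows "\<exists>F. frame (P \<times> E) (grp \<circ> fst) F"
proof -
  obtain F where F: "\<And>B. B \<in> Bs \<Longrightarrow> frame (B \<times> E) fst (F B)" using fr by metis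
  note D = frameD[OF F]
  define G where "G = (\<Union>B\<in>Bs. F B)"
  have 1: "length g = 5 \<and> set g \<subseteq> P \<times> E \<and>
      swap_teams g \<in> G \<and> (\<forall>i<5. \<forall>j<5. i \<noteq> j \<longrightarrow> (grp \<circ> fst) (g ! i) \<noteq> (grp \<circ> fst) (g ! j))"
    if "g \<in> G" for g
  proof -
    from that obtain B where B: "B \<in> Bs" "g \<in> F B" by (auto simp: G_def)
    have "grp (fst (g ! i)) \<noteq> grp (fst (g ! j))" if "i < 5" "j < 5" "i \<noteq> j" for i j
    proof -
      have "fst (g ! i) \<noteq> fst (g ! j)" using D(4)[OF B that] .
      moreover have "fst (g ! i) \<in> B" "fst (g ! j) \<in> B" using D(2)[OF B] that by (auto simp: mem_Times_iff)
      ultimately show ?thesis using inj[OF B(1)] by (auto dest: inj_onD)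
    qed
    moreover have "B \<times> E \<subseteq> P \<times> E" using sub[OF B(1)] by blast
    ultimately show ?thesis using D(1,3,5)[OF B] B(1) unfolding G_def comp_def by blast
  qed
  have 2: "\<exists>!g. g \<in> G \<and> g ! i = x \<and> g ! j = y"
    if ij: "i < 5" "j < 5" "i \<noteq> j" and xy: "x \<in> P \<times> E" "y \<in> P \<times> E" "(grp \<circ> fst) x \<noteq> (grp \<circ> fst) y"
    for i j x y
  proof -
    have "fst x \<in> P" "fst y \<in> P" "grp (fst x) \<noteq> grp (fst y)" using xy by auto
    then have "\<exists>!B. B \<in> Bs \<and> fst x \<in> B \<and> fst y \<in> B" by (rule lin)
    then obtain B where B: "B \<in> Bs" "fst x \<in> B" "fst y \<in> B"
      and uB: "\<And>B'. B' \<in> Bs \<Longrightarrow> fst x \<in> B' \<Longrightarrow> fst y \<in> B' \<Longrightarrow> B' = B" by blast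
    have "x \<in> B \<times> E" "y \<in> B \<times> E" "fst x \<noteq> fst y"
      using B(2,3) xy unfolding mem_Times_iff comp_def by metis+
    then have "\<exists>!g. g \<in> F B \<and> g ! i = x \<and> g ! j = y" by (rule frame_ex1[OF F[OF B(1)] ij])
    moreover have "g \<in> G \<and> g ! i = x \<and> g ! j = y \<longleftrightarrow> g \<in> F B \<and> g ! i = x \<and> g ! j = y" for g
    proof
      assume g: "g \<in> G \<and> g ! i = x \<and> g ! j = y"
      then obtain B' where B': "B' \<in> Bs" "g \<in> F B'" by (auto simp: G_def)
      have "g ! i \<in> B' \<times> E" "g ! j \<in> B' \<times> E" using D(2)[OF B'] ij by auto
      then have "B' = B" using uB[OF B'(1)] g by (auto simp: mem_Times_iff)
      then show "g \<in> F B \<and> g ! i = x \<and> g ! j = y" using B' g by simp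
    qed (use B(1) in \<open>unfold G_def, blast\<close>)
    ultimately show ?thesis by simp
  qed
  have "frame (P \<times> E) (grp \<circ> fst) G" by (rule frameI) (use 1 in blast, use 1 in blast, (rule 2; assumption))
  then show ?thesis by blast
qed

section \<open>Symmetry between the columns\<close>

text \<open>The permutation of the columns that \<open>swap_teams\<close> effects; the round column
  is fixed.\<close>

definition other_team :: "nat \<Rightarrow> nat" where
  "other_team i = (if i = 0 then 2 else if i = 1 then 3 else if i = 2 then 0 else if i = 3 then 1 else i)"

text \<open>\<open>swap_teams\<close> is an involution of \<open>G\<close>, so it carries the one
  row found through the exchanged columns to the one row wanted.\<close>

lemma ex1_swap_columns:
  assumes G: "\<And>g. g \<in> G \<Longrightarrow> length g = 5 \<and> swap_teams g \<in> G" and ij: "i < 5" "j < 5"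
    and ex: "\<exists>!g. g \<in> G \<and> g ! (other_team i) = x \<and> g ! (other_team j) = y"
  shows "\<exists>!g. g \<in> G \<and> g ! i = x \<and> g ! j = y"
proof -
  have five: "l = 0 \<or> l = 1 \<or> l = 2 \<or> l = 3 \<or> l = 4" if "l < 5" for l :: nat using that by linarith
  have nth: "swap_teams g ! l = g ! (other_team l)" "swap_teams g ! (other_team l) = g ! l"
    if "l < 5" for g :: "'a list" and l
    using five[OF that] by (auto simp: swap_teams_def other_team_def)
  have swap_swap: "swap_teams (swap_teams g) = g" if "length g = 5" for g :: "'a list"
    using that by (auto simp: swap_teams_def length_Suc_conv numeral_eq_Suc)
  obtain g where g: "g \<in> G" "g ! (other_team i) = x" "g ! (other_team j) = y"
    and uniq: "\<And>h. h \<in> G \<Longrightarrow> h ! (other_team i) = x \<Longrightarrow> h ! (other_team j) = y \<Longrightarrow> h = g"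
    using ex by blast
  show ?thesis
  proof (rule ex1I[of _ "swap_teams g"])
    show "swap_teams g \<in> G \<and> swap_teams g ! i = x \<and> swap_teams g ! j = y"
      using G[OF g(1)] g(2,3) nth(1)[OF ij(1), of g] nth(1)[OF ij(2), of g] by simp
  next
    fix h assume h: "h \<in> G \<and> h ! i = x \<and> h ! j = y"
    then have "swap_teams h = g"
      using uniq[of "swap_teams h"] G[of h] nth(2)[OF ij(1), of h] nth(2)[OF ij(2), of h] by simp
    then show "h = swap_teams g" using G[of h] h swap_swap[of h] by simp
  qed
qed

text \<open>Reversal and exchange of teams leave six classes of ordered column pairs:
  \<open>(0, 2)\<close> and \<open>(1, 3)\<close> are exchanged with their own reversals, while
  \<open>(0, 1)\<close>, \<open>(0, 3)\<close>, \<open>(0, 4)\<close>, \<open>(1, 4)\<close> go to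
  \<open>(2, 3)\<close>, \<open>(2, 1)\<close>, \<open>(2, 4)\<close>,
  \<open>(3, 4)\<close>.\<close>

lemma column_pair_cases:
  fixes i j :: nat
  assumes "i < 5" "j < 5" "i \<noteq> j"
  shows "\<exists>(l, l') \<in> {(0, 1), (0, 2), (0, 3), (0, 4), (1, 3), (1, 4)}.
    (i, j) = (l, l') \<or> (i, j) = (l', l) \<or>
    (other_team i, other_team j) = (l, l') \<or> (other_team i, other_team j) = (l', l)"
proof -
  have five: "l = 0 \<or> l = 1 \<or> l = 2 \<or> l = 3 \<or> l = 4" if "l < 5" for l :: nat using that by linarith
  show ?thesis using five[OF assms(1)] five[OF assms(2)] assms(3)
    by (elim disjE) (simp_all add: other_team_def)
qed

text \<open>Both orders of \<open>x\<close> and \<open>y\<close> are required since some column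
  pairs are reached only after a reversal. The condition on \<open>same_sex\<close> allows a use for
  mixed pairs alone, where same-sex pairs may repeat.\<close>

lemma ex1_all_columns:
  assumes G: "\<And>g. g \<in> G \<Longrightarrow> length g = 5 \<and> swap_teams g \<in> G"
    and ij: "i < 5" "j < 5" "i \<noteq> j"
    and ex: "\<And>l l'. (l, l') \<in> {(0, 1), (0, 2), (0, 3), (0, 4), (1, 3), (1, 4)} \<Longrightarrow>
      same_sex l l' \<longleftrightarrow> same_sex i j \<Longrightarrow>
      (\<exists>!g. g \<in> G \<and> g ! l = x \<and> g ! l' = y) \<and> (\<exists>!g. g \<in> G \<and> g ! l = y \<and> g ! l' = x)"
  shows "\<exists>!g. g \<in> G \<and> g ! i = x \<and> g ! j = y"
proof -
  have five: "l = 0 \<or> l = 1 \<or> l = 2 \<or> l = 3 \<or> l = 4" if "l < 5" for l :: nat using that by linarith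
  have ss: "same_sex (other_team i) (other_team j) \<longleftrightarrow> same_sex i j"
    using five[OF ij(1)] five[OF ij(2)] by (elim disjE) (simp_all add: same_sex_cases other_team_def)
  have comm: "(\<exists>!g. g \<in> G \<and> g ! l = y \<and> g ! l' = x) \<longleftrightarrow> (\<exists>!g. g \<in> G \<and> g ! l' = x \<and> g ! l = y)" for l l'
    by (rule arg_cong[of _ _ Ex1], rule ext, blast)
  obtain p where p: "p \<in> {(0, 1), (0, 2), (0, 3), (0, 4), (1, 3), (1, 4)}"
    "case p of (l, l') \<Rightarrow> (i, j) = (l, l') \<or> (i, j) = (l', l) \<or>
      (other_team i, other_team j) = (l, l') \<or> (other_team i, other_team j) = (l', l)"
    by (rule bexE[OF column_pair_cases[OF ij]])
  obtain l l' where pl: "p = (l, l')" by (rule prod.exhaust)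
  have ll: "(l, l') \<in> {(0, 1), (0, 2), (0, 3), (0, 4), (1, 3), (1, 4)}" using p(1) unfolding pl .
  have c: "(i, j) = (l, l') \<or> (i, j) = (l', l) \<or>
      (other_team i, other_team j) = (l, l') \<or> (other_team i, other_team j) = (l', l)"
    using p(2) unfolding pl prod.case .
  have "same_sex l l' \<longleftrightarrow> same_sex i j" using c ss same_sex_sym[of l l'] by (elim disjE) (simp_all only: prod.inject)
  then have e: "\<exists>!g. g \<in> G \<and> g ! l = x \<and> g ! l' = y" "\<exists>!g. g \<in> G \<and> g ! l' = x \<and> g ! l = y"
    using ex[OF ll] unfolding comm by simp_all
  from c show ?thesis
  proof (elim disjE)
    assume "(other_team i, other_team j) = (l, l')"
    then show ?thesis using e(1) by (intro ex1_swap_columns[OF G ij(1,2)]) simp_all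
  next
    assume "(other_team i, other_team j) = (l', l)"
    then show ?thesis using e(2) by (intro ex1_swap_columns[OF G ij(1,2)]) simp_all
  qed (use e in simp_all)
qed

section \<open>Holes of size 2, and frames on standard point sets\<close>

text \<open>For \<open>c < k\<close> the points \<open>c\<close> and \<open>c + k\<close> are mates;
  the points from \<open>2 * k\<close> on share the label \<open>k\<close>. Mates at distance
  \<open>k\<close> stay mates under addition modulo \<open>2 * k\<close>, and under rotation of
  segments whose length divides \<open>k\<close>.\<close>

definition hole :: "nat \<Rightarrow> nat \<Rightarrow> nat" where
  "hole k x = (if x < 2 * k then x mod k else k)"

definition realizable :: "nat \<Rightarrow> bool" where
  "realizable n \<longleftrightarrow> (\<exists>G. schedule {0..<2 * n} G)"

definition uniform_frame :: "nat \<Rightarrow> bool" where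
  "uniform_frame n \<longleftrightarrow> (\<exists>G. frame {0..<2 * n} (\<lambda>x. x div 2) G)"

lemma schedule_of_card:
  assumes "realizable n" "finite Y" "card Y = 2 * n"
  shows "\<exists>G. schedule Y G"
proof -
  obtain G where G: "schedule {0..<2 * n} G" using assms by (auto simp: realizable_def)
  obtain f where "bij_betw f {0..<card Y} Y" using ex_bij_betw_nat_finite[OF assms(2)] by blast
  then have "inj_on f {0..<2 * n}" "f ` {0..<2 * n} = Y" using assms(3) by (auto simp: bij_betw_def)
  then show ?thesis using schedule_image[OF G] by metis
qed

lemma realizable_of_card:
  assumes "schedule Y G" "finite Y" "card Y = 2 * n"
  shows "realizable n"
proof -
  obtain f where "bij_betw f Y {0..<card Y}" using ex_bij_betw_finite_nat[OF assms(2)] by blast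
  then have "inj_on f Y" "f ` Y = {0..<2 * n}" using assms(3) by (auto simp: bij_betw_def)
  then show ?thesis using schedule_image[OF assms(1)] unfolding realizable_def by metis
qed

text \<open>Serves frames without points at infinity, and groups from which truncation removes
  everything.\<close>

lemma realizable_0: "realizable 0"
  unfolding realizable_def by (rule exI[of _ "{}"]) (simp add: schedule_def)

lemma ex1_filter:
  assumes "length (filter P L) = 1"
  shows "\<exists>!g. g \<in> set L \<and> P g"
proof -
  obtain g where "filter P L = [g]" using assms by (auto simp: length_Suc_conv)
  then have "{g \<in> set L. P g} = {g}" by (metis set_filter list.set(1) list.set(2))
  then have "g' \<in> set L \<and> P g' \<longleftrightarrow> g' = g" for g' by blast
  then show ?thesis by simp
qed

text \<open>The two games are M0 F0 v M1 F1 in round 0 and M0 F1 v M1 F0 in round 1. Opponents of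
  the same sex meet twice. This array fills every hole of size 2.\<close>

lemma realizable_1: "realizable 1"
proof -
  define L :: "nat list list" where "L = [[0, 0, 1, 1, 0], [1, 1, 0, 0, 0], [0, 1, 1, 0, 1], [1, 0, 0, 1, 1]]"
  define IJ where "IJ = filter (\<lambda>(i, j). i \<noteq> j) (List.product [0..<5] [0..<5::nat])"
  define XY :: "(nat \<times> nat) list" where "XY = List.product [0, 1] [0, 1]"
  have IJ: "(i, j) \<in> set IJ" if "i < 5" "j < 5" "i \<noteq> j" for i j using that by (simp add: IJ_def)
  have XY: "(x, y) \<in> set XY" if "x \<in> {0, 1}" "y \<in> {0, 1}" for x y using that by (auto simp: XY_def)
  have "list_all (\<lambda>p. list_all (\<lambda>z. same_sex (fst p) (snd p) \<or>
      length (filter (\<lambda>g. g ! fst p = fst z \<and> g ! snd p = snd z) L) = 1) XY) IJ"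
    unfolding L_def IJ_def XY_def same_sex_cases by code_simp
  then have A: "\<forall>p\<in>set IJ. \<forall>z\<in>set XY. same_sex (fst p) (snd p) \<or>
      length (filter (\<lambda>g. g ! fst p = fst z \<and> g ! snd p = snd z) L) = 1"
    by (simp only: list_all_iff)
  have 1: "length (filter (\<lambda>g. g ! i = x \<and> g ! j = y) L) = 1"
    if "i < 5" "j < 5" "i \<noteq> j" "\<not> same_sex i j" "x \<in> {0, 1}" "y \<in> {0, 1}" for i j x y
    using bspec[OF bspec[OF A IJ[OF that(1-3)]] XY[OF that(5,6)]] that(4) by (simp only: fst_conv snd_conv simp_thms)
  have "list_all (\<lambda>p. list_all (\<lambda>z. fst z = snd z \<or>
      list_ex (\<lambda>g. g ! fst p = fst z \<and> g ! snd p = snd z) L) XY) IJ"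
    unfolding L_def IJ_def XY_def by code_simp
  then have B: "\<forall>p\<in>set IJ. \<forall>z\<in>set XY. fst z = snd z \<or>
      (\<exists>g\<in>set L. g ! fst p = fst z \<and> g ! snd p = snd z)"
    by (simp only: list_all_iff list_ex_iff)
  have 2: "\<exists>g\<in>set L. g ! i = x \<and> g ! j = y"
    if "i < 5" "j < 5" "i \<noteq> j" "x \<in> {0, 1}" "y \<in> {0, 1}" "x \<noteq> y" for i j x y
    using bspec[OF bspec[OF B IJ[OF that(1-3)]] XY[OF that(4,5)]] that(6) by (simp only: fst_conv snd_conv simp_thms)
  have X: "{0..<2 * 1} = {0, 1::nat}"
    by (simp add: atLeast0LessThan lessThan_Suc numeral_2_eq_2 insert_commute)
  have L: "\<forall>g\<in>set L. length g = 5 \<and> set g \<subseteq> {0, 1} \<and> g ! 0 \<noteq> g ! 2 \<and> g ! 1 \<noteq> g ! 3 \<and> swap_teams g \<in> set L"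
    unfolding L_def by (simp add: swap_teams_def)
  have "schedule {0..<2 * 1} (set L)" unfolding X
  proof (rule scheduleI)
    show "length g = 5 \<and> set g \<subseteq> {0, 1} \<and> g ! 0 \<noteq> g ! 2 \<and> g ! 1 \<noteq> g ! 3 \<and> swap_teams g \<in> set L"
      if "g \<in> set L" for g
      using L that by blast
  qed ((rule 2; assumption), (rule ex1_filter, rule 1; assumption))
  then show ?thesis unfolding realizable_def by blast
qed

lemma hole_classes:
  assumes "0 < k"
  shows "c < k \<Longrightarrow> {x \<in> {0..<2 * k + 2 * t}. hole k x = c} = {c, c + k}"
    "{x \<in> {0..<2 * k + 2 * t}. hole k x = k} = {2 * k..<2 * k + 2 * t}"
    "x \<in> {0..<2 * k + 2 * t} \<Longrightarrow> hole k x \<le> k"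
proof -
  have n: "x mod k < k" for x using assms by simp
  then have n': "x mod k \<noteq> k" for x using nat_neq_iff by blast
  show "{x \<in> {0..<2 * k + 2 * t}. hole k x = c} = {c, c + k}" if c: "c < k"
  proof -
    have "x \<in> {0..<2 * k + 2 * t} \<and> hole k x = c \<longleftrightarrow> x \<in> {c, c + k}" for x
    proof (cases "x < 2 * k")
      case True
      have "x mod k = (if x < k then x else x - k)" using True by (simp add: le_mod_geq)
      then show ?thesis using True c unfolding hole_def by (cases "x < k") auto
    next
      case False
      then show ?thesis using c unfolding hole_def by auto
    qed
    then show ?thesis by blast
  qed
  show "{x \<in> {0..<2 * k + 2 * t}. hole k x = k} = {2 * k..<2 * k + 2 * t}"
    using n' by (auto simp: hole_def split: if_splits)
  show "hole k x \<le> k" using n[of x] by (simp add: hole_def)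
qed

lemma realizable_of_frame:
  assumes F: "frame {0..<2 * k + 2 * t} (hole k) F" and k: "0 < k" and t: "realizable t"
  shows "realizable (k + t)"
proof -
  have "\<exists>G. schedule {0..<2 * k + 2 * t} G"
  proof (rule schedule_fill_holes[OF F])
    fix c assume "c \<in> hole k ` {0..<2 * k + 2 * t}"
    then have "c \<le> k" using hole_classes(3)[OF k] by blast
    then consider "c < k" | "c = k" by linarith
    then show "\<exists>G. schedule {x \<in> {0..<2 * k + 2 * t}. hole k x = c} G"
    proof cases
      case 1
      have "card {c, c + k} = 2 * 1" using k by simp
      then show ?thesis unfolding hole_classes(1)[OF k 1] by (intro schedule_of_card[OF realizable_1]) simp_all
    next
      case 2
      show ?thesis unfolding 2 hole_classes(2)[OF k] by (intro schedule_of_card[OF t]) simp_all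
    qed
  qed
  then show ?thesis by (auto simp: realizable_def distrib_left)
qed

text \<open>For \<open>t = 0\<close> the infinite hole is empty and for \<open>t = 1\<close> it has
  two points, so all holes have size 2 and only the labels must change.\<close>

lemma uniform_frame_of_frame:
  assumes F: "frame {0..<2 * k + 2 * t} (hole k) F" and k: "0 < k" and t: "t \<le> 1"
  shows "uniform_frame (k + t)"
proof -
  \<comment> \<open>Interleaves the two halves: \<open>c\<close> goes to \<open>2 * c\<close> and
    its mate \<open>c + k\<close> to \<open>2 * c + 1\<close>. For \<open>t = 1\<close> the infinite
    points \<open>2 * k\<close> and \<open>2 * k + 1\<close> are already consecutive.\<close>
  define f where "f x = (if x < 2 * k then 2 * (x mod k) + x div k else x)" for x
  have d: "x div k \<le> 1" if "x < 2 * k" for x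
    using that less_mult_imp_div_less[of x 2 k] by simp
  have fdiv: "f x div 2 = hole k x" if "x \<in> {0..<2 * k + 2 * t}" for x
    using that d[of x] t by (auto simp: f_def hole_def)
  have fmod: "f x mod 2 = x div k" if "x < 2 * k" for x
    using d[OF that] that by (auto simp: f_def)
  have inj: "inj_on f {0..<2 * k + 2 * t}"
  proof (rule inj_onI)
    fix x y assume xy: "x \<in> {0..<2 * k + 2 * t}" "y \<in> {0..<2 * k + 2 * t}" and eq: "f x = f y"
    have h: "hole k x = hole k y" using fdiv[OF xy(1)] fdiv[OF xy(2)] eq by simp
    have n: "z mod k \<noteq> k" for z using k by (metis less_irrefl mod_less_divisor)
    show "x = y"
    proof (cases "x < 2 * k")
      case True
      then have y: "y < 2 * k" using h n by (auto simp: hole_def split: if_splits)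
      have "x mod k = y mod k" using h True y by (simp add: hole_def)
      moreover have "x div k = y div k" using fmod[OF True] fmod[OF y] eq by simp
      ultimately show ?thesis by (metis div_mult_mod_eq)
    next
      case False
      then have "\<not> y < 2 * k" using h n[of y] by (auto simp: hole_def split: if_splits)
      then show ?thesis using False eq by (simp add: f_def)
    qed
  qed
  have "f ` {0..<2 * k + 2 * t} \<subseteq> {0..<2 * (k + t)}"
  proof
    fix z assume "z \<in> f ` {0..<2 * k + 2 * t}"
    then obtain x where x: "x \<in> {0..<2 * k + 2 * t}" "z = f x" by blast
    show "z \<in> {0..<2 * (k + t)}"
    proof (cases "x < 2 * k")
      case True
      have "x mod k < k" using k by simp
      then have "2 * (x mod k) + x div k < 2 * k" using d[OF True] by linarith
      then show ?thesis using x True by (simp add: f_def)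
    qed (use x in \<open>simp add: f_def\<close>)
  qed
  then have im: "f ` {0..<2 * k + 2 * t} = {0..<2 * (k + t)}"
    by (rule card_subset_eq[rotated]) (simp_all add: card_image[OF inj])
  have "frame (f ` {0..<2 * k + 2 * t}) (\<lambda>x. x div 2) (map f ` F)"
    by (rule frame_image[OF F inj]) (simp add: fdiv)
  then show ?thesis unfolding im uniform_frame_def by blast
qed

lemma frame_on_block:
  assumes u: "uniform_frame (card B)" and fin: "finite B"
  shows "\<exists>F. frame (B \<times> {0, 1::nat}) fst F"
proof -
  obtain G where G: "frame {0..<2 * card B} (\<lambda>x. x div 2) G" using u by (auto simp: uniform_frame_def)
  obtain e where e: "bij_betw e {0..<card B} B" using ex_bij_betw_nat_finite[OF fin] by blast
  define f where "f x = (e (x div 2), x mod 2)" for x :: nat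
  have lt: "x div 2 \<in> {0..<card B}" if "x \<in> {0..<2 * card B}" for x using that by auto
  have einj: "e (x div 2) = e (y div 2) \<longleftrightarrow> x div 2 = y div 2"
    if "x \<in> {0..<2 * card B}" "y \<in> {0..<2 * card B}" for x y
    using inj_on_eq_iff[OF bij_betw_imp_inj_on[OF e] lt[OF that(1)] lt[OF that(2)]] .
  have inj: "inj_on f {0..<2 * card B}"
  proof (rule inj_onI)
    fix x y assume "x \<in> {0..<2 * card B}" "y \<in> {0..<2 * card B}" "f x = f y"
    then have "x div 2 = y div 2" "x mod 2 = y mod 2" using einj by (auto simp: f_def)
    then show "x = y" by (metis div_mult_mod_eq)
  qed
  have "f ` {0..<2 * card B} = B \<times> {0, 1}"
  proof (rule card_subset_eq)
    show "f ` {0..<2 * card B} \<subseteq> B \<times> {0, 1}"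
    proof
      fix z assume "z \<in> f ` {0..<2 * card B}"
      then obtain x where x: "x \<in> {0..<2 * card B}" "z = f x" by blast
      have "e (x div 2) \<in> B" using bij_betwE[OF e] lt[OF x(1)] by blast
      moreover have "x mod 2 = 0 \<or> x mod 2 = 1" by auto
      ultimately show "z \<in> B \<times> {0, 1}" by (simp add: x(2) f_def)
    qed
  qed (simp_all add: fin card_image[OF inj] card_cartesian_product)
  moreover have "frame (f ` {0..<2 * card B}) fst (map f ` G)"
    by (rule frame_image[OF G inj]) (simp add: f_def einj)
  ultimately show ?thesis by metis
qed

section \<open>Truncated transversal designs\<close>

text \<open>Index 0 is the slope at infinity and index \<open>i > 0\<close> the form
  \<open>x + (i - 1) * y\<close>. Coordinate 0 is left unreduced, as \<open>y < m\<close> wherever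
  it is used.\<close>

definition td_coord :: "nat \<Rightarrow> nat \<Rightarrow> nat \<Rightarrow> nat \<Rightarrow> nat" where
  "td_coord m i x y = (if i = 0 then y else (x + (i - 1) * y) mod m)"

text \<open>Two of the linear forms have determinant \<open>j - i\<close>, or 1 up to sign if one of
  them is \<open>y\<close>. Differences of positive indices up to \<open>K\<close> lie below
  \<open>K\<close>, so \<open>cop\<close> makes every determinant invertible modulo
  \<open>m\<close>.\<close>

lemma td_coord_inj:
  assumes ij: "i < j" "j \<le> K" and cop: "\<And>d. 0 < d \<Longrightarrow> d < K \<Longrightarrow> coprime d m"
    and lt: "x < m" "y < m" "x' < m" "y' < m"
    and eq: "td_coord m i x y = td_coord m i x' y'" "td_coord m j x y = td_coord m j x' y'"
  shows "x = x' \<and> y = y'"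
proof -
  have same_y: "x = x'" if "y = y'" "0 < l" "td_coord m l x y = td_coord m l x' y'" for l
  proof -
    have "[x + (l - 1) * y = x' + (l - 1) * y] (mod m)" using that by (simp add: td_coord_def cong_def)
    then have "[x = x'] (mod m)" using cong_add_rcancel_nat by blast
    then show ?thesis using lt by (simp add: cong_def)
  qed
  show ?thesis
  proof (cases "i = 0")
    case True
    then have "y = y'" using eq(1) by (simp add: td_coord_def)
    then show ?thesis using same_y[of j] ij eq(2) by simp
  next
    case False
    have "[x + (i - 1) * y = x' + (i - 1) * y'] (mod m)" "[x + (j - 1) * y = x' + (j - 1) * y'] (mod m)"
      using eq False ij by (auto simp: td_coord_def cong_def)
    \<comment> \<open>In the integers the congruences can be subtracted without truncation, which
      eliminates \<open>x\<close>.\<close>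
    then have "[int (x + (i - 1) * y) = int (x' + (i - 1) * y')] (mod int m)"
      "[int (x + (j - 1) * y) = int (x' + (j - 1) * y')] (mod int m)"
      by (simp_all only: cong_int_iff)
    then have "[int (x + (j - 1) * y) - int (x + (i - 1) * y) = int (x' + (j - 1) * y') - int (x' + (i - 1) * y')] (mod int m)"
      using cong_diff by blast
    moreover have "int (z + (j - 1) * w) - int (z + (i - 1) * w) = int (j - i) * int w" for z w
    proof -
      have "j - 1 = (j - i) + (i - 1)" using ij False by simp
      then obtain a d where "i - 1 = a" "j - i = d" "j - 1 = d + a" by blast
      then show ?thesis by (simp add: distrib_right)
    qed
    ultimately have "[int (j - i) * int y = int (j - i) * int y'] (mod int m)" by simp
    then have "[(j - i) * y = (j - i) * y'] (mod m)" by (metis cong_int_iff of_nat_mult)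
    moreover have "coprime (j - i) m" using cop[of "j - i"] ij False by simp
    ultimately have "[y = y'] (mod m)" using cong_mult_lcancel_nat by blast
    then have "y = y'" using lt by (simp add: cong_def)
    then show ?thesis using same_y[of i] False eq(1) by simp
  qed
qed

text \<open>Two coordinates map the \<open>m * m\<close> pairs injectively into a set of the same
  size, hence onto it.\<close>

lemma td_coord_ex1:
  assumes ij: "i \<noteq> j" "i \<le> K" "j \<le> K" and cop: "\<And>d. 0 < d \<Longrightarrow> d < K \<Longrightarrow> coprime d m"
    and uv: "u < m" "v < m"
  obtains x y where "x < m" "y < m" "td_coord m i x y = u" "td_coord m j x y = v"
    "\<And>x' y'. x' < m \<Longrightarrow> y' < m \<Longrightarrow> td_coord m i x' y' = u \<Longrightarrow> td_coord m j x' y' = v \<Longrightarrow> x' = x \<and> y' = y"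
proof -
  define S where "S = {..<m} \<times> {..<m}"
  define f where "f p = (td_coord m i (fst p) (snd p), td_coord m j (fst p) (snd p))" for p
  have inj2: "x = x' \<and> y = y'" if "x < m" "y < m" "x' < m" "y' < m"
    "td_coord m i x y = td_coord m i x' y'" "td_coord m j x y = td_coord m j x' y'" for x y x' y'
    using td_coord_inj[of i j K m x y x' y'] td_coord_inj[of j i K m x y x' y'] that ij cop
    by (cases "i < j") auto
  have inj: "inj_on f S"
    by (rule inj_onI) (use inj2 in \<open>auto simp: f_def S_def\<close>)
  have "0 < m" using uv by simp
  then have "f ` S \<subseteq> S" by (auto simp: f_def S_def td_coord_def)
  moreover have "finite S" by (simp add: S_def)
  ultimately have "f ` S = S" by (intro card_subset_eq card_image[OF inj])
  then have "(u, v) \<in> f ` S" using uv by (simp add: S_def)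
  then obtain x y where xy: "x < m" "y < m" "td_coord m i x y = u" "td_coord m j x y = v"
    by (auto simp: f_def S_def)
  have "x' = x \<and> y' = y" if "x' < m" "y' < m" "td_coord m i x' y' = u" "td_coord m j x' y' = v" for x' y'
    by (rule inj2[OF that(1,2) xy(1,2)]) (simp_all only: that xy)
  then show ?thesis by (rule that[OF xy])
qed

text \<open>The design has \<open>5 + length ws\<close> groups of size \<open>m\<close>. Five stay
  whole, so every block keeps at least 5 points; the others shrink to the sizes in
  \<open>ws\<close>. Blocks then have the sizes for which \<open>fr\<close> supplies frames, and the
  doubled groups, of sizes \<open>2 * m\<close> and \<open>2 * w\<close>, are filled by
  schedules.\<close>

lemma realizable_td:
  assumes m: "realizable m" "0 < m"
    and ws: "\<And>w. w \<in> set ws \<Longrightarrow> w \<le> m \<and> realizable w"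
    and cop: "\<And>d. 0 < d \<Longrightarrow> d < 4 + length ws \<Longrightarrow> coprime d m"
    and fr: "\<And>s. 5 \<le> s \<Longrightarrow> s \<le> 5 + length ws \<Longrightarrow> uniform_frame s"
  shows "realizable (5 * m + sum_list ws)"
proof -
  define vs where "vs = replicate 5 m @ ws"
  define K where "K = length vs"
  have vs: "vs ! i \<le> m \<and> realizable (vs ! i)" if "i < K" for i
    using nth_mem[of i vs] that m(1) ws unfolding K_def vs_def by auto
  have vs5: "vs ! i = m" if "i < 5" for i using that by (simp add: vs_def nth_append)
  have K: "K = 5 + length ws" by (simp add: K_def vs_def)
  define P where "P = (SIGMA i:{..<K}. {..<vs ! i})"
  \<comment> \<open>The block of \<open>(x, y)\<close> takes from group \<open>i\<close> the point
    with the right coordinate, provided that truncation has kept it.\<close>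
  define blk where "blk x y = {(i, td_coord m i x y) | i. i < K \<and> td_coord m i x y < vs ! i}" for x y
  define Bs where "Bs = {blk x y | x y. x < m \<and> y < m}"
  have cardP: "card P = 5 * m + sum_list vs - 5 * m"
    by (simp add: P_def K_def sum_list_sum_nth atLeast0LessThan)
  have "sum_list vs = 5 * m + sum_list ws" by (simp add: vs_def numeral_eq_Suc)
  then have cardP: "card P = 5 * m + sum_list ws" using cardP by simp
  have blk_sub: "blk x y \<subseteq> P" for x y by (auto simp: blk_def P_def)
  have blk_inj: "inj_on fst (blk x y)" for x y by (auto simp: blk_def inj_on_def)
  have finP: "finite P" by (simp add: P_def)
  have blk_card: "5 \<le> card (blk x y) \<and> card (blk x y) \<le> 5 + length ws" if "x < m" "y < m" for x y
  proof
    have "fst ` blk x y \<subseteq> {..<K}" by (auto simp: blk_def)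
    then have "card (fst ` blk x y) \<le> card {..<K}" by (intro card_mono) simp_all
    then show "card (blk x y) \<le> 5 + length ws" using card_image[OF blk_inj[of x y]] K by simp
    have "td_coord m i x y < m" for i using that by (simp add: td_coord_def)
    then have "(i, td_coord m i x y) \<in> blk x y" if "i < 5" for i
      using that vs5[OF that] K by (simp add: blk_def)
    then have "{..<5} \<subseteq> fst ` blk x y" by force
    moreover have "finite (blk x y)" using finite_subset[OF blk_sub finP] .
    ultimately have "card {..<5::nat} \<le> card (fst ` blk x y)" by (intro card_mono) auto
    then show "5 \<le> card (blk x y)" using card_image[OF blk_inj[of x y]] by simp
  qed
  have "\<exists>F. frame (P \<times> {0, 1::nat}) (fst \<circ> fst) F"
  proof (rule frame_from_blocks[of Bs])
    show "B \<subseteq> P" if "B \<in> Bs" for B using that blk_sub by (auto simp: Bs_def)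
    show "inj_on fst B" if "B \<in> Bs" for B using that blk_inj by (auto simp: Bs_def)
    show "\<exists>F. frame (B \<times> {0, 1::nat}) fst F" if "B \<in> Bs" for B
    proof -
      from that obtain x y where B: "B = blk x y" "x < m" "y < m" by (auto simp: Bs_def)
      show ?thesis unfolding B(1)
        by (rule frame_on_block[OF fr finite_subset[OF blk_sub finP]]) (use blk_card[OF B(2,3)] in auto)
    qed
    show "\<exists>!B. B \<in> Bs \<and> p \<in> B \<and> q \<in> B" if pq: "p \<in> P" "q \<in> P" "fst p \<noteq> fst q" for p q
    proof -
      obtain i u where p: "p = (i, u)" by (rule prod.exhaust)
      obtain j v where q: "q = (j, v)" by (rule prod.exhaust)
      have i: "i < K" "u < vs ! i" "j < K" "v < vs ! j" "i \<noteq> j" using pq unfolding p q P_def by simp_all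
      have uv: "u < m" "v < m" using i(2,4) vs[OF i(1)] vs[OF i(3)] by linarith+
      \<comment> \<open>The largest coordinate index is \<open>K - 1 = 4 + length ws\<close>, which
        explains the range of \<open>d\<close> in \<open>cop\<close>.\<close>
      have cop': "coprime d m" if "0 < d" "d < K - 1" for d using cop[of d] that K by simp
      obtain x y where xy: "x < m" "y < m" "td_coord m i x y = u" "td_coord m j x y = v"
        and un: "\<And>x' y'. x' < m \<Longrightarrow> y' < m \<Longrightarrow> td_coord m i x' y' = u \<Longrightarrow> td_coord m j x' y' = v \<Longrightarrow> x' = x \<and> y' = y"
      proof (rule td_coord_ex1[of i j "K - 1" m u v])
        show "i \<noteq> j" "i \<le> K - 1" "j \<le> K - 1" "u < m" "v < m" using i uv by simp_all
      qed (use cop' in blast)+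
      show ?thesis
      proof (rule ex1I[of _ "blk x y"])
        show "blk x y \<in> Bs \<and> p \<in> blk x y \<and> q \<in> blk x y"
          using xy(1,2) i unfolding p q Bs_def blk_def xy(3,4)[symmetric] by blast
      next
        fix B assume B: "B \<in> Bs \<and> p \<in> B \<and> q \<in> B"
        then obtain x' y' where B': "x' < m" "y' < m" "B = blk x' y'" by (auto simp: Bs_def)
        have "p \<in> blk x' y'" "q \<in> blk x' y'" using B B'(3) by blast+
        then have "td_coord m i x' y' = u" "td_coord m j x' y' = v" unfolding p q blk_def by blast+
        then show "B = blk x y" using un[OF B'(1,2)] B'(3) by simp
      qed
    qed
  qed
  then obtain F where F: "frame (P \<times> {0, 1::nat}) (fst \<circ> fst) F" by blast
  have "\<exists>G. schedule (P \<times> {0, 1::nat}) G"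
  proof (rule schedule_fill_holes[OF F])
    fix i assume "i \<in> (fst \<circ> fst) ` (P \<times> {0, 1::nat})"
    then have i: "i < K" by (auto simp: P_def)
    have "{x \<in> P \<times> {0, 1::nat}. (fst \<circ> fst) x = i} = ({i} \<times> {..<vs ! i}) \<times> {0, 1}"
      using i by (auto simp: P_def)
    then show "\<exists>G. schedule {x \<in> P \<times> {0, 1::nat}. (fst \<circ> fst) x = i} G"
      using schedule_of_card[of "vs ! i" "({i} \<times> {..<vs ! i}) \<times> {0, 1::nat}"] vs[OF i]
      by (simp add: card_cartesian_product)
  qed
  then obtain G where "schedule (P \<times> {0, 1::nat}) G" by blast
  moreover have "card (P \<times> {0, 1::nat}) = 2 * (5 * m + sum_list ws)"
    by (simp add: card_cartesian_product cardP)
  moreover have "finite (P \<times> {0, 1::nat})" using finP by simp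
  ultimately show ?thesis by (metis realizable_of_card)
qed

section \<open>Developing base games under a cyclic group\<close>

text \<open>
  Points \<open>x < 2k\<close> are moved by the cyclic group of order \<open>m\<close>; the others are points at infinity.
  The flag \<open>r\<close> marks the round column: under \<open>cyclic_act\<close> infinite players are fixed, but infinite
  rounds are swapped in pairs, so that a base game in an infinite round has orbit length \<open>2k\<close>.
\<close>

definition block_act :: "nat \<Rightarrow> nat \<Rightarrow> bool \<Rightarrow> nat \<Rightarrow> nat \<Rightarrow> nat" where
  "block_act k m r s x = (if x < 2 * k then x div m * m + (x + s) mod m else x)"

definition cyclic_act :: "nat \<Rightarrow> bool \<Rightarrow> nat \<Rightarrow> nat \<Rightarrow> nat" where
  "cyclic_act k r s x =
     (if x < 2 * k then (x + s) mod (2 * k)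
      else if r then 2 * (x div 2) + (x + s) mod 2 else x)"

text \<open>A representative of the orbit of \<open>(x, y)\<close>, for pairs with a finite entry:
  the pivot, which is \<open>x\<close> if finite and else \<open>y\<close>, is shifted to residue 0
  modulo \<open>m\<close>. For a pivot of residue 0 the shift is \<open>m\<close>, which acts as the
  identity.\<close>

definition canon :: "(bool \<Rightarrow> nat \<Rightarrow> nat \<Rightarrow> nat) \<Rightarrow> nat \<Rightarrow> nat \<Rightarrow> nat \<Rightarrow> nat \<Rightarrow> nat \<Rightarrow> nat \<Rightarrow> nat \<times> nat" where
  "canon act k m i j x y =
     (let s = m - (if x < 2 * k then x else y) mod m in (act (i = 4) s x, act (j = 4) s y))"

text \<open>What the two actions have in common. By \<open>act_mod\<close> the action is free on
  finite points, whereas points at infinity may be fixed; orbits of pairs therefore have full length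
  only if one entry is finite.\<close>

locale base_games =
  fixes k t m :: nat and act :: "bool \<Rightarrow> nat \<Rightarrow> nat \<Rightarrow> nat" and B :: "nat list list"
  assumes k_pos: "0 < k" and m_pos: "0 < m"
    and act_lt: "x < 2 * k + 2 * t \<Longrightarrow> act r s x < 2 * k + 2 * t"
    and act_finite: "act r s x < 2 * k \<longleftrightarrow> x < 2 * k"
    and act_agree: "x < 2 * k \<Longrightarrow> act r s x = act False s x"
    and act_add: "act r s (act r s' x) = act r (s + s') x"
    and act_period: "act r m x = x"
    and act_mod: "x < 2 * k \<Longrightarrow> act r s x mod m = (x + s) mod m"
    and act_hole: "x < 2 * k \<Longrightarrow> y < 2 * k \<Longrightarrow>
      act False s x mod k = act False s y mod k \<longleftrightarrow> x mod k = y mod k"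
begin

abbreviation X where "X \<equiv> {0..<2 * k + 2 * t}"

definition col :: "nat \<Rightarrow> nat \<Rightarrow> nat \<Rightarrow> nat" where
  "col i = act (i = 4)"

definition shift :: "nat \<Rightarrow> nat list \<Rightarrow> nat list" where
  "shift s g = map (\<lambda>i. col i s (g ! i)) [0..<5]"

definition B' where "B' = B @ map swap_teams B"

definition G where "G = {shift s g | s g. s < m \<and> g \<in> set B'}"

lemma act_mult_period: "act r (n * m) x = x"
proof (induction n)
  case 0
  \<comment> \<open>Shift 0 is the identity because it is absorbed by shift \<open>m\<close>, which
    is.\<close>
  have "act r 0 (act r m x) = act r m x" using act_add[of r 0 m x] by simp
  then show ?case by (simp add: act_period)
next
  case (Suc n)
  then show ?case using act_add[of r m "n * m" x] by (simp add: act_period)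
qed

lemma act_cong: "s mod m = s' mod m \<Longrightarrow> act r s x = act r s' x"
proof -
  assume eq: "s mod m = s' mod m"
  have "act r s x = act r (s mod m) x" for s
    using act_add[of r "s mod m" "s div m * m" x] by (simp add: act_mult_period)
  then show ?thesis using eq by metis
qed

lemma col_lt: "x \<in> X \<Longrightarrow> col i s x \<in> X"
  using act_lt[of x "i = 4" s] by (simp add: col_def)

text \<open>Columns \<open>i\<close> and \<open>j\<close> may act differently on points at infinity,
  but all of those lie in the one hole \<open>k\<close>.\<close>

lemma hole_col_eq:
  assumes "x \<in> X" "y \<in> X"
  shows "hole k (col i s x) = hole k (col j s y) \<longleftrightarrow> hole k x = hole k y"
proof -
  have n: "z mod k < k" for z using k_pos by simp
  have n1: "z mod k \<noteq> k" "k \<noteq> z mod k" for z using n[of z] by linarith+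
  have c: "hole k (col l s z) = (if z < 2 * k then act False s z mod k else k)" for l z
    using act_finite[of "l = 4" s z] act_agree[of z "l = 4" s]
    by (cases "z < 2 * k") (simp_all add: hole_def col_def)
  show ?thesis unfolding c
    by (cases "x < 2 * k"; cases "y < 2 * k") (simp_all only: hole_def if_True if_False n1 act_hole)
qed

text \<open>Shifting the pair by \<open>s\<close> changes the normalising shift by
  \<open>- s\<close> modulo \<open>m\<close>, and the two cancel.\<close>

lemma canon_col:
  assumes "x \<in> X" "y \<in> X" "x < 2 * k \<or> y < 2 * k"
  shows "canon act k m i j (col i s x) (col j s y) = canon act k m i j x y"
proof -
  define z where "z = (if x < 2 * k then x else y)"
  define z' where "z' = (if col i s x < 2 * k then col i s x else col j s y)"
  have z: "z < 2 * k" and z': "z' mod m = (z + s) mod m"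
    using assms act_finite[of "i = 4" s x] act_mod[of x "i = 4" s] act_mod[of y "j = 4" s]
    by (auto simp: z_def z'_def col_def)
  have "(m - (z + s) mod m + s) mod m = (m - z mod m) mod m"
  proof -
    have "[m - (z + s) mod m + (z + s) mod m = m - z mod m + z mod m] (mod m)"
      using m_pos by (simp add: less_imp_le)
    then have "[m - (z + s) mod m + (z + s) = m - z mod m + z] (mod m)"
      by (metis cong_def mod_add_right_eq)
    then have "[(m - (z + s) mod m + s) + z = m - z mod m + z] (mod m)"
      by (simp add: ac_simps)
    then show ?thesis using cong_add_rcancel_nat unfolding cong_def by blast
  qed
  then have *: "col l (m - z' mod m) (col l s w) = col l (m - z mod m) w" for l w
    unfolding col_def act_add z' by (rule act_cong)
  show ?thesis unfolding canon_def Let_def col_def[symmetric] z_def[symmetric] z'_def[symmetric] * ..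
qed

lemma shift_nth: "i < 5 \<Longrightarrow> shift s g ! i = col i s (g ! i)"
  by (simp add: shift_def)

lemma length_shift: "length (shift s g) = 5"
  by (simp add: shift_def)

lemma swap_shift: "length g = 5 \<Longrightarrow> swap_teams (shift s g) = shift s (swap_teams g)"
  by (simp add: swap_teams_def shift_def col_def upt_rec numeral_eq_Suc)

lemma col_inj:
  assumes "x < 2 * k" "s < m" "s' < m" "col i s x = col i s' x"
  shows "s = s'"
proof -
  have "(x + s) mod m = (x + s') mod m"
    using assms(1,4) act_mod[of x "i = 4" s] act_mod[of x "i = 4" s'] by (simp add: col_def)
  then have "s mod m = s' mod m" using cong_add_lcancel_nat[of x s s' m] by (simp add: cong_def)
  then show ?thesis using assms by simp
qed

text \<open>A finite point has \<open>2 * k + 2 * t - 2\<close> points outside its hole, a point at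
  infinity has \<open>2 * k\<close>.\<close>

lemma card_different_holes:
  "card {(x, y). x \<in> X \<and> y \<in> X \<and> hole k x \<noteq> hole k y} = 4 * k * (k - 1 + 2 * t)"
proof -
  have fin: "{y \<in> X. hole k y = hole k x} = {x mod k, x mod k + k}" if "x < 2 * k" for x
  proof -
    have "y \<in> {y \<in> X. hole k y = hole k x} \<longleftrightarrow> y \<in> {x mod k, x mod k + k}" for y
    proof -
      have n: "x mod k < k" using k_pos by simp
      then have n': "k \<noteq> x mod k" by linarith
      show ?thesis
      proof (cases "y < 2 * k")
        case True
        have "y mod k = (if y < k then y else y - k)" using True by (simp add: le_mod_geq)
        then show ?thesis using True that n unfolding hole_def by (cases "y < k") auto
      next
        case False
        then have "hole k y \<noteq> hole k x" using that n' unfolding hole_def by simp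
        then show ?thesis using False n by auto
      qed
    qed
    then show ?thesis by blast
  qed
  have inf: "{y \<in> X. hole k y = hole k x} = {2 * k..<2 * k + 2 * t}" if "2 * k \<le> x" for x
  proof -
    have "y mod k \<noteq> k" for y using k_pos by (metis less_irrefl mod_less_divisor)
    then show ?thesis using that by (auto simp: hole_def split: if_splits)
  qed
  have 1: "card {y \<in> X. hole k x \<noteq> hole k y} = 2 * k + 2 * t - card {y \<in> X. hole k y = hole k x}" for x
  proof -
    have "{y \<in> X. hole k x \<noteq> hole k y} = X - {y \<in> X. hole k y = hole k x}" by auto
    moreover have "card (X - {y \<in> X. hole k y = hole k x}) = card X - card {y \<in> X. hole k y = hole k x}"
      by (rule card_Diff_subset) auto
    ultimately show ?thesis by simp
  qed
  have c1: "card {y \<in> X. hole k x \<noteq> hole k y} = 2 * k + 2 * t - 2" if "x < 2 * k" for x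
  proof -
    have "card {x mod k, x mod k + k} = 2" using k_pos by simp
    then show ?thesis unfolding 1 fin[OF that] by simp
  qed
  have c2: "card {y \<in> X. hole k x \<noteq> hole k y} = 2 * k" if "2 * k \<le> x" for x
    unfolding 1 inf[OF that] by simp
  have "{(x, y). x \<in> X \<and> y \<in> X \<and> hole k x \<noteq> hole k y} = Sigma X (\<lambda>x. {y \<in> X. hole k x \<noteq> hole k y})"
    by auto
  then have "card {(x, y). x \<in> X \<and> y \<in> X \<and> hole k x \<noteq> hole k y} =
      (\<Sum>x\<in>X. card {y \<in> X. hole k x \<noteq> hole k y})"
    by simp
  also have "\<dots> = (\<Sum>x\<in>{0..<2 * k} \<union> {2 * k..<2 * k + 2 * t}. card {y \<in> X. hole k x \<noteq> hole k y})"
    by (rule sum.cong) auto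
  also have "\<dots> = (\<Sum>x\<in>{0..<2 * k}. card {y \<in> X. hole k x \<noteq> hole k y}) +
      (\<Sum>x\<in>{2 * k..<2 * k + 2 * t}. card {y \<in> X. hole k x \<noteq> hole k y})"
    by (rule sum.union_disjoint) auto
  also have "(\<Sum>x\<in>{0..<2 * k}. card {y \<in> X. hole k x \<noteq> hole k y}) = (\<Sum>x\<in>{0..<2 * k}. 2 * k + 2 * t - 2)"
    by (rule sum.cong[OF refl], rule c1) simp
  also have "(\<Sum>x\<in>{2 * k..<2 * k + 2 * t}. card {y \<in> X. hole k x \<noteq> hole k y}) = (\<Sum>x\<in>{2 * k..<2 * k + 2 * t}. 2 * k)"
    by (rule sum.cong[OF refl], rule c2) simp
  also have "(\<Sum>x\<in>{0..<2 * k}. 2 * k + 2 * t - 2) + (\<Sum>x\<in>{2 * k..<2 * k + 2 * t}. 2 * k) = 4 * k * (k - 1 + 2 * t)"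
    using k_pos by (cases k) (simp_all add: algebra_simps)
  finally show ?thesis .
qed

definition admissible :: "nat list \<Rightarrow> bool" where
  "admissible g \<longleftrightarrow> length g = 5 \<and> set g \<subseteq> X \<and> distinct (map (hole k) g)"

lemma admissible_nth:
  assumes "admissible g"
  shows "i < 5 \<Longrightarrow> g ! i \<in> X" "i < 5 \<Longrightarrow> j < 5 \<Longrightarrow> i \<noteq> j \<Longrightarrow> hole k (g ! i) \<noteq> hole k (g ! j)"
    "i < 5 \<Longrightarrow> j < 5 \<Longrightarrow> i \<noteq> j \<Longrightarrow> g ! i < 2 * k \<or> g ! j < 2 * k"
proof -
  have "length g = 5" "set g \<subseteq> X" using assms by (simp_all add: admissible_def)
  then show *: "i < 5 \<Longrightarrow> g ! i \<in> X" for i by (metis nth_mem subsetD)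
  show **: "i < 5 \<Longrightarrow> j < 5 \<Longrightarrow> i \<noteq> j \<Longrightarrow> hole k (g ! i) \<noteq> hole k (g ! j)"
    using assms nth_eq_iff_index_eq[of "map (hole k) g" i j] by (simp add: admissible_def)
  show "i < 5 \<Longrightarrow> j < 5 \<Longrightarrow> i \<noteq> j \<Longrightarrow> g ! i < 2 * k \<or> g ! j < 2 * k"
    using ** by (auto simp: hole_def split: if_splits)
qed

text \<open>Distinct canonical forms put the base pairs into different orbits, and a finite entry
  gives each orbit length \<open>m\<close>. The \<open>m * length B'\<close> shifted pairs are thus
  different, and as many as all pairs satisfying \<open>T\<close>, so none is missing: counting
  turns at most once into exactly once. For frames \<open>T\<close> means different holes, for
  incomplete schedules not both at infinity.\<close>

lemma ex1_columns:
  fixes T :: "nat \<Rightarrow> nat \<Rightarrow> bool"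
  assumes ij: "i < 5" "j < 5" "i \<noteq> j"
    and adm: "\<And>g. g \<in> set B' \<Longrightarrow> g ! i \<in> X \<and> g ! j \<in> X \<and> T (g ! i) (g ! j)"
    and inv: "\<And>x y s. x \<in> X \<Longrightarrow> y \<in> X \<Longrightarrow> T x y \<Longrightarrow> T (col i s x) (col j s y)"
    and fin: "\<And>x y. x \<in> X \<Longrightarrow> y \<in> X \<Longrightarrow> T x y \<Longrightarrow> x < 2 * k \<or> y < 2 * k"
    and card: "card {(x, y). x \<in> X \<and> y \<in> X \<and> T x y} = m * length B'"
    and dist: "distinct (map (\<lambda>g. canon act k m i j (g ! i) (g ! j)) B')"
    and xy: "x \<in> X" "y \<in> X" "T x y"
  shows "\<exists>!g. g \<in> G \<and> g ! i = x \<and> g ! j = y"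
proof -
  define D where "D = {..<m} \<times> set B'"
  define pr where "pr = (\<lambda>(s, g). (col i s (g ! i), col j s (g ! j)))"
  define Q where "Q = {(x, y). x \<in> X \<and> y \<in> X \<and> T x y}"
  have adm3: "g ! i \<in> X" "g ! j \<in> X" "T (g ! i) (g ! j)" "g ! i < 2 * k \<or> g ! j < 2 * k" if "g \<in> set B'" for g
    using adm[OF that] fin[of "g ! i" "g ! j"] by blast+
  have inj: "inj_on pr D"
  proof (rule inj_onI, clarsimp simp: pr_def D_def)
    fix s g s' g' assume s: "s < m" "s' < m" and g: "g \<in> set B'" "g' \<in> set B'"
      and eq: "col i s (g ! i) = col i s' (g' ! i)" "col j s (g ! j) = col j s' (g' ! j)"
    note a = adm3[OF g(1)] and a' = adm3[OF g(2)]
    have "canon act k m i j (g ! i) (g ! j) = canon act k m i j (g' ! i) (g' ! j)"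
      using canon_col[OF a(1,2,4), of i j s] canon_col[OF a'(1,2,4), of i j s'] eq by simp
    then have "g = g'" using dist g by (auto simp: distinct_map dest: inj_onD)
    moreover have "s = s'" using a(4) col_inj[OF _ s] eq \<open>g = g'\<close> by blast
    ultimately show "s = s' \<and> g = g'" by simp
  qed
  have "pr ` D \<subseteq> Q"
  proof
    fix z assume "z \<in> pr ` D"
    then obtain s g where g: "g \<in> set B'" and z: "z = (col i s (g ! i), col j s (g ! j))"
      by (auto simp: pr_def D_def)
    note a = adm3[OF g]
    show "z \<in> Q" unfolding z Q_def
      using col_lt[OF a(1), of i s] col_lt[OF a(2), of j s] inv[OF a(1,2,3), of s] by simp
  qed
  moreover have "finite Q" by (rule finite_subset[of _ "X \<times> X"]) (auto simp: Q_def)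
  moreover have "card (pr ` D) = card Q"
  proof -
    have "card (pr ` D) = m * card (set B')" using card_image[OF inj] by (simp add: D_def card_cartesian_product)
    moreover have "distinct B'" using dist by (simp add: distinct_map)
    ultimately show ?thesis using card by (simp add: distinct_card Q_def)
  qed
  ultimately have "pr ` D = Q" by (intro card_subset_eq)
  then have "(x, y) \<in> pr ` D" using xy by (simp add: Q_def)
  then obtain s g where sg: "s < m" "g \<in> set B'" "col i s (g ! i) = x" "col j s (g ! j) = y"
    unfolding D_def pr_def by auto
  show ?thesis
  proof (rule ex1I[of _ "shift s g"])
    show "shift s g \<in> G \<and> shift s g ! i = x \<and> shift s g ! j = y"
      using sg(1,2) unfolding G_def shift_nth[OF ij(1)] shift_nth[OF ij(2)] sg(3,4) by blast
  next
    fix g' assume g': "g' \<in> G \<and> g' ! i = x \<and> g' ! j = y"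
    then obtain s0 g0 where 0: "s0 < m" "g0 \<in> set B'" "g' = shift s0 g0" by (auto simp: G_def)
    then have "pr (s0, g0) = pr (s, g)" using g' sg ij by (simp add: pr_def shift_nth)
    then have "(s0, g0) = (s, g)" by (rule inj_onD[OF inj]) (use 0 sg in \<open>auto simp: D_def\<close>)
    then show "g' = shift s g" using 0 by simp
  qed
qed

lemma frame_G:
  assumes adm: "\<And>g. g \<in> set B \<Longrightarrow> admissible g" and card: "m * (2 * length B) = 4 * k * (k - 1 + 2 * t)"
    and dist: "\<And>i j. (i, j) \<in> {(0, 1), (0, 2), (0, 3), (0, 4), (1, 3), (1, 4)} \<Longrightarrow>
      distinct (map (\<lambda>g. canon act k m i j (g ! i) (g ! j)) B')"
  shows "frame X (hole k) G"
proof (rule frameI)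
  have len: "length g = 5" if "g \<in> set B" for g using adm[OF that] by (simp add: admissible_def)
  have adm_swap: "admissible (swap_teams g)" if g: "g \<in> set B" for g
  proof -
    obtain a b c d r where "g = [a, b, c, d, r]"
      using len[OF g] by (auto simp: length_Suc_conv numeral_eq_Suc)
    then show ?thesis using adm[OF g] by (auto simp: admissible_def swap_teams_def)
  qed
  have adm': "admissible g" if "g \<in> set B'" for g
    using that adm adm_swap by (auto simp: B'_def)
  have swsw: "swap_teams (swap_teams g) = g" if "g \<in> set B" for g
    using len[OF that] by (auto simp: swap_teams_def length_Suc_conv numeral_eq_Suc)
  have sw: "swap_teams g \<in> set B'" if "g \<in> set B'" for g
    using that swsw by (auto simp: B'_def)
  have B'5: "length g = 5" if "g \<in> set B'" for g using adm'[OF that] by (simp add: admissible_def)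
  show GD: "length g = 5 \<and> set g \<subseteq> X \<and> swap_teams g \<in> G" if "g \<in> G" for g
  proof -
    from that obtain s g0 where g0: "s < m" "g0 \<in> set B'" "g = shift s g0" by (auto simp: G_def)
    have "g ! i \<in> X" if "i < 5" for i
      unfolding g0(3) shift_nth[OF that] by (rule col_lt[OF admissible_nth(1)[OF adm'[OF g0(2)] that]])
    then have "set g \<subseteq> X" using length_shift[of s g0] unfolding g0(3) by (metis in_set_conv_nth subsetI)
    moreover have "swap_teams g \<in> G"
      unfolding g0(3) swap_shift[OF B'5[OF g0(2)]] G_def using g0(1) sw[OF g0(2)] by blast
    ultimately show ?thesis using length_shift[of s g0] g0(3) by blast
  qed
  show "hole k (g ! i) \<noteq> hole k (g ! j)" if "g \<in> G" "i < 5" "j < 5" "i \<noteq> j" for g i j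
  proof -
    from that obtain s g0 where g0: "g0 \<in> set B'" "g = shift s g0" by (auto simp: G_def)
    note a = admissible_nth[OF adm'[OF g0(1)]]
    show ?thesis unfolding g0(2) shift_nth[OF that(2)] shift_nth[OF that(3)]
      using hole_col_eq[OF a(1)[OF that(2)] a(1)[OF that(3)]] a(2)[OF that(2-4)] by blast
  qed
  have ex1: "\<exists>!g. g \<in> G \<and> g ! i = x \<and> g ! j = y"
    if ij: "(i, j) \<in> {(0, 1), (0, 2), (0, 3), (0, 4), (1, 3), (1, 4)}"
      and xy: "x \<in> X" "y \<in> X" "hole k x \<noteq> hole k y" for i j x y
  proof (rule ex1_columns[where T = "\<lambda>x y. hole k x \<noteq> hole k y"])
    show ij5: "i < 5" "j < 5" "i \<noteq> j" using ij by auto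
    show "card {(x, y). x \<in> X \<and> y \<in> X \<and> hole k x \<noteq> hole k y} = m * length B'"
      using card card_different_holes by (simp add: B'_def mult_2)
    show "g ! i \<in> X \<and> g ! j \<in> X \<and> hole k (g ! i) \<noteq> hole k (g ! j)" if "g \<in> set B'" for g
      using admissible_nth(1,2)[OF adm'[OF that]] ij5 by simp
    show "x < 2 * k \<or> y < 2 * k" if "hole k x \<noteq> hole k y" for x y
      using that by (auto simp: hole_def split: if_splits)
  qed (use hole_col_eq dist[OF ij] xy in \<open>simp_all\<close>)
  show "\<exists>!g. g \<in> G \<and> g ! i = x \<and> g ! j = y"
    if ij: "i < 5" "j < 5" "i \<noteq> j" and xy: "x \<in> X" "y \<in> X" "hole k x \<noteq> hole k y" for i j x y
  proof (rule ex1_all_columns[OF _ ij])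
    show "length g = 5 \<and> swap_teams g \<in> G" if "g \<in> G" for g using GD[OF that] by blast
    show "(\<exists>!g. g \<in> G \<and> g ! l = x \<and> g ! l' = y) \<and> (\<exists>!g. g \<in> G \<and> g ! l = y \<and> g ! l' = x)"
      if "(l, l') \<in> {(0, 1), (0, 2), (0, 3), (0, 4), (1, 3), (1, 4)}" for l l'
      using ex1[OF that xy] ex1[OF that xy(2,1) xy(3)[symmetric]] by (rule conjI)
  qed
qed

lemma card_not_both_infinite:
  "card {(x, y). x \<in> X \<and> y \<in> X \<and> (x < 2 * k \<or> y < 2 * k)} = 4 * k * (k + 2 * t)"
proof -
  have "{(x, y). x \<in> X \<and> y \<in> X \<and> (x < 2 * k \<or> y < 2 * k)} =
      X \<times> X - {2 * k..<2 * k + 2 * t} \<times> {2 * k..<2 * k + 2 * t}" by auto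
  moreover have "card (X \<times> X - {2 * k..<2 * k + 2 * t} \<times> {2 * k..<2 * k + 2 * t}) =
      card (X \<times> X) - card ({2 * k..<2 * k + 2 * t} \<times> {2 * k..<2 * k + 2 * t})"
    by (rule card_Diff_subset) auto
  ultimately show ?thesis by (simp add: card_cartesian_product algebra_simps)
qed

text \<open>Equal canonical forms mean equal orbits. This yields mere existence, which is what
  same-sex pairs need where they may repeat.\<close>

lemma ex_of_canon_eq:
  assumes g: "g \<in> set B'" and ij: "i < 5" "j < 5"
    and eq: "canon act k m i j x y = canon act k m i j (g ! i) (g ! j)"
  shows "\<exists>h\<in>G. h ! i = x \<and> h ! j = y"
proof -
  define z where "z = (if x < 2 * k then x else y) mod m"
  obtain s' where s': "col i (m - z) x = col i s' (g ! i)" "col j (m - z) y = col j s' (g ! j)"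
    using eq unfolding canon_def Let_def col_def z_def by blast
  have z: "z < m" using m_pos by (simp add: z_def)
  \<comment> \<open>First the shift \<open>s'\<close> of the base pair to the common canonical form,
    then \<open>z\<close> to undo the normalisation of \<open>(x, y)\<close>.\<close>
  define s where "s = (z + s') mod m"
  have "col l z (col l (m - z) w) = w" for l w
    unfolding col_def act_add using z by (simp add: act_period)
  moreover have "col l z (col l s' w) = col l s w" for l w
    unfolding col_def act_add s_def by (rule act_cong) simp
  ultimately have "x = col i s (g ! i)" "y = col j s (g ! j)" using s' by metis+
  moreover have "shift s g \<in> G" using g m_pos unfolding G_def s_def by (auto intro!: exI[of _ "(z + s') mod m"])
  ultimately show ?thesis using shift_nth[OF ij(1), of s g] shift_nth[OF ij(2), of s g] by blast
qed

end

text \<open>The finite points fall into segments of length \<open>m\<close>, each rotated in itself.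
  As \<open>m\<close> divides \<open>k\<close>, mates \<open>c\<close> and \<open>c + k\<close> have
  the same position in their segments, and keep it in common.\<close>

lemma base_games_block_act:
  assumes k: "0 < k" and m: "m dvd k"
  shows "base_games k t m (block_act k m)"
proof unfold_locales
  obtain c where c: "k = m * c" using m by blast
  show m0: "0 < m" using k c by simp
  have lt: "x div m * m + y mod m < 2 * k" if "x < 2 * k" for x y
  proof -
    have "x div m < 2 * c" using that by (intro less_mult_imp_div_less) (simp add: c mult_ac)
    then have "Suc (x div m) * m \<le> 2 * c * m" by (intro mult_le_mono1) simp
    moreover have "y mod m < m" using m0 by simp
    ultimately show ?thesis by (simp add: c mult_ac)
  qed
  show "block_act k m r s x < 2 * k + 2 * t" if "x < 2 * k + 2 * t" for x r s
    using that lt[of x "x + s"] by (cases "x < 2 * k") (simp_all add: block_act_def)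
  show "block_act k m r s x < 2 * k \<longleftrightarrow> x < 2 * k" for r s x
    using lt[of x "x + s"] by (simp add: block_act_def)
  show "block_act k m r s (block_act k m r s' x) = block_act k m r (s + s') x" for r s s' x
  proof (cases "x < 2 * k")
    case True
    have "(x div m * m + (x + s') mod m + s) mod m = ((x + s') mod m + s) mod m"
      using mod_mult_self3[of "x div m" m "(x + s') mod m + s"] by (simp only: add.assoc)
    also have "\<dots> = (x + (s + s')) mod m" by (simp add: mod_simps ac_simps)
    finally show ?thesis using True lt[OF True, of "x + s'"] m0 by (simp add: block_act_def)
  qed (simp add: block_act_def)
  show "block_act k m r s x mod m = (x + s) mod m" if "x < 2 * k" for x r s
    using that by (simp add: block_act_def)
  show "block_act k m False s x mod k = block_act k m False s y mod k \<longleftrightarrow> x mod k = y mod k"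
    if "x < 2 * k" "y < 2 * k" for x y s
  proof -
    \<comment> \<open>With \<open>k = m * c\<close>, a residue modulo \<open>k\<close> has two
      digits: the segment number modulo \<open>c\<close>, which the action preserves, and the
      position modulo \<open>m\<close>, which it advances.\<close>
    have split: "a mod k = b mod k \<longleftrightarrow> a div m mod c = b div m mod c \<and> a mod m = b mod m" for a b
    proof
      assume "a mod k = b mod k"
      then have "(a mod (m * c)) div m = (b mod (m * c)) div m" "(a mod (m * c)) mod m = (b mod (m * c)) mod m"
        by (simp_all add: c)
      then show "a div m mod c = b div m mod c \<and> a mod m = b mod m"
        using m0 by (simp add: mod_mult2_eq)
    qed (simp add: c mod_mult2_eq)
    have "(x + s) mod m = (y + s) mod m \<longleftrightarrow> x mod m = y mod m"
      using cong_add_rcancel_nat[of x s y m] by (simp add: cong_def)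
    then show ?thesis using that m0 by (simp add: block_act_def split)
  qed
qed (simp_all add: block_act_def k)

text \<open>All finite points form one orbit of length \<open>2 * k\<close>. If an infinite round
  were fixed, the shifts of a base game in it, in both team orders, would give it
  \<open>4 * k\<close> rows where only \<open>2 * k\<close> are due. Odd shifts therefore exchange
  the infinite rounds \<open>2 * j\<close> and \<open>2 * j + 1\<close>; as \<open>2 * k\<close> is
  even, such a pair never straddles the border of the finite points.\<close>

lemma base_games_cyclic_act:
  assumes k: "0 < k"
  shows "base_games k t (2 * k) (cyclic_act k)"
proof unfold_locales
  define e where "e x s = 2 * (x div 2) + (x + s) mod 2" for x s :: nat
  have act: "cyclic_act k r s x = (if x < 2 * k then (x + s) mod (2 * k) else if r then e x s else x)" for r s x
    by (simp add: cyclic_act_def e_def)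
  have e_div: "e x s div 2 = x div 2" for x s by (simp add: e_def)
  have e_add: "e (e x s') s = e x (s + s')" for x s s'
  proof -
    have "(2 * (x div 2) + (x + s') mod 2 + s) mod 2 = ((x + s') mod 2 + s) mod 2"
      using mod_mult_self4[of 2 "x div 2" "(x + s') mod 2 + s"] by (simp only: add.assoc)
    also have "\<dots> = (x + (s + s')) mod 2" by (simp add: mod_simps ac_simps)
    finally show ?thesis using e_div[of x s'] unfolding e_def by simp
  qed
  have e_lt: "e x s < 2 * l \<longleftrightarrow> x < 2 * l" for x s l
    using e_div[of x s] div_less_iff_less_mult[of 2 "e x s" l] div_less_iff_less_mult[of 2 x l]
    by (simp add: mult.commute)
  have lt: "(x + s) mod (2 * k) < 2 * k" for x s using k by simp
  show "cyclic_act k r s x < 2 * k + 2 * t" if "x < 2 * k + 2 * t" for x r s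
    using that lt[of x s] e_lt[of x s "k + t"] by (simp add: act)
  show fin: "cyclic_act k r s x < 2 * k \<longleftrightarrow> x < 2 * k" for r s x
    using lt[of x s] e_lt[of x s k] by (simp add: act)
  show "cyclic_act k r s (cyclic_act k r s' x) = cyclic_act k r (s + s') x" for r s s' x
  proof (cases "x < 2 * k")
    case True
    have "((x + s') mod (2 * k) + s) mod (2 * k) = (x + (s + s')) mod (2 * k)"
      by (simp add: mod_simps add.commute add.left_commute)
    then show ?thesis using True lt[of x s'] by (simp add: act)
  next
    case False
    then show ?thesis using e_lt[of x s' k] by (simp add: act e_add)
  qed
  show "cyclic_act k r (2 * k) x = x" for r x by (simp add: act e_def)
  show "cyclic_act k r s x mod (2 * k) = (x + s) mod (2 * k)" if "x < 2 * k" for x r s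
    using that by (simp add: act)
  show "cyclic_act k False s x mod k = cyclic_act k False s y mod k \<longleftrightarrow> x mod k = y mod k"
    if "x < 2 * k" "y < 2 * k" for x y s
    using that cong_add_rcancel_nat[of x s y k] by (simp add: act mod_mod_cancel cong_def)
qed (simp_all add: cyclic_act_def k)

section \<open>Executable criteria for base games\<close>

text \<open>Quicksort with the head as pivot. The checks are evaluated by rewriting, where comparing
  all pairs of entries would be costly.\<close>

fun quick_distinct :: "nat list \<Rightarrow> bool" where
  "quick_distinct [] = True"
| "quick_distinct (x # xs) = (list_all (\<lambda>y. y \<noteq> x) xs \<and>
     quick_distinct (filter (\<lambda>y. y < x) xs) \<and> quick_distinct (filter (\<lambda>y. x < y) xs))"

lemma distinct_filter_split:
  "distinct (filter P xs) \<Longrightarrow> distinct (filter (\<lambda>x. \<not> P x) xs) \<Longrightarrow> distinct xs"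
  by (induction xs) (auto split: if_splits)

lemma quick_distinct_imp_distinct: "quick_distinct xs \<Longrightarrow> distinct xs"
proof (induction xs rule: quick_distinct.induct)
  case (2 x xs)
  have "filter (\<lambda>y. x < y) xs = filter (\<lambda>y. \<not> y < x) xs"
    using 2(3) by (intro filter_cong) (auto simp: list_all_iff)
  then have "distinct xs" using 2 distinct_filter_split[of "\<lambda>y. y < x" xs] by simp
  then show ?case using 2(3) by (auto simp: list_all_iff)
qed simp

text \<open>Pairs are coded as single numbers for \<open>quick_distinct\<close>. Distinct codes come
  from distinct pairs, so soundness does not rest on injectivity of the coding.\<close>

definition base_check :: "(bool \<Rightarrow> nat \<Rightarrow> nat \<Rightarrow> nat) \<Rightarrow> nat \<Rightarrow> nat \<Rightarrow> nat \<Rightarrow> nat list list \<Rightarrow> bool" where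
  "base_check act k t m B \<longleftrightarrow>
     m * (2 * length B) = 4 * k * (k - 1 + 2 * t) \<and>
     list_all (\<lambda>g. length g = 5 \<and> list_all (\<lambda>x. x < 2 * k + 2 * t) g \<and> distinct (map (hole k) g)) B \<and>
     (let B' = B @ map swap_teams B in
      list_all (\<lambda>(i, j). quick_distinct (map (\<lambda>g.
          case canon act k m i j (g ! i) (g ! j) of (x, y) \<Rightarrow> x * (2 * k + 2 * t) + y) B'))
        [(0, 1), (0, 2), (0, 3), (0, 4), (1, 3), (1, 4)])"

lemma (in base_games) frame_of_base_check:
  assumes "base_check act k t m B"
  shows "\<exists>F. frame {0..<2 * k + 2 * t} (hole k) F"
proof -
  have "frame X (hole k) G"
  proof (rule frame_G)
    show "m * (2 * length B) = 4 * k * (k - 1 + 2 * t)" using assms by (simp add: base_check_def)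
    show "admissible g" if "g \<in> set B" for g
      using assms that by (auto simp: base_check_def admissible_def list_all_iff)
    fix i j :: nat assume "(i, j) \<in> {(0, 1), (0, 2), (0, 3), (0, 4), (1, 3), (1, 4)}"
    then have "(i, j) \<in> set [(0, 1), (0, 2), (0, 3), (0, 4), (1, 3), (1, 4)]" by simp
    then have "quick_distinct (map (\<lambda>g. case canon act k m i j (g ! i) (g ! j) of (x, y) \<Rightarrow> x * (2 * k + 2 * t) + y) B')"
      using assms unfolding base_check_def Let_def B'_def list_all_iff by blast
    then have "distinct (map (\<lambda>g. case canon act k m i j (g ! i) (g ! j) of (x, y) \<Rightarrow> x * (2 * k + 2 * t) + y) B')"
      by (rule quick_distinct_imp_distinct)
    then show "distinct (map (\<lambda>g. canon act k m i j (g ! i) (g ! j)) B')"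
      by (auto simp: distinct_map inj_on_def)
  qed
  then show ?thesis by blast
qed

definition mixed_column_pairs :: "(nat \<times> nat) list" where
  "mixed_column_pairs = [(0, 1), (0, 3), (0, 4), (1, 4)]"

text \<open>Here the points at infinity are the only hole, and finite mates may meet. Four finite
  entries per game exclude pairs with both entries at infinity. Mixed pairs are counted exactly;
  since same-sex pairs may repeat, for them only coverage is tested, on one normalised pair per
  orbit.\<close>

definition incomplete_check :: "(bool \<Rightarrow> nat \<Rightarrow> nat \<Rightarrow> nat) \<Rightarrow> nat \<Rightarrow> nat \<Rightarrow> nat \<Rightarrow> nat list list \<Rightarrow> bool" where
  "incomplete_check act k t m B \<longleftrightarrow>
     m * (2 * length B) = 4 * k * (k + 2 * t) \<and>
     list_all (\<lambda>g. length g = 5 \<and> list_all (\<lambda>x. x < 2 * k + 2 * t) g \<and>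
       length (filter (\<lambda>x. x < 2 * k) g) \<ge> 4 \<and> g ! 0 \<noteq> g ! 2 \<and> g ! 1 \<noteq> g ! 3) B \<and>
     (let B' = B @ map swap_teams B in
      list_all (\<lambda>(i, j). quick_distinct (map (\<lambda>g.
          case canon act k m i j (g ! i) (g ! j) of (x, y) \<Rightarrow> x * (2 * k + 2 * t) + y) B')) mixed_column_pairs \<and>
      list_all (\<lambda>(i, j). let C = map (\<lambda>g. canon act k m i j (g ! i) (g ! j)) B' in
          list_all (\<lambda>x. list_all (\<lambda>y. List.member C (canon act k m i j x y))
            (filter (\<lambda>y. x \<noteq> y \<and> (x < 2 * k \<or> y < 2 * k) \<and> (if x < 2 * k then x else y) mod m = 0)
              [0..<2 * k + 2 * t])) [0..<2 * k + 2 * t])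
        [(0, 2), (1, 3)])"

text \<open>Developed games have at most one entry at infinity, rows of the schedule
  \<open>R\<close> on the hole have nothing else. A pair of points in two columns therefore belongs
  to only one of the two parts.\<close>

lemma (in base_games) realizable_of_incomplete_check:
  assumes chk: "incomplete_check act k t m B" and t: "realizable t"
  shows "realizable (k + t)"
proof -
  define J where "J = {2 * k..<2 * k + 2 * t}"
  obtain R where R: "schedule J R" using schedule_of_card[OF t, of J] by (auto simp: J_def)
  define ok where "ok g \<longleftrightarrow> length g = 5 \<and> (\<forall>i<5. g ! i \<in> X) \<and> g ! 0 \<noteq> g ! 2 \<and> g ! 1 \<noteq> g ! 3 \<and>
    (\<forall>i<5. \<forall>j<5. i \<noteq> j \<longrightarrow> g ! i < 2 * k \<or> g ! j < 2 * k)" for g :: "nat list"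
  have okB: "ok g \<and> ok (swap_teams g) \<and> swap_teams (swap_teams g) = g" if g: "g \<in> set B" for g
  proof -
    have c: "length g = 5" "\<forall>x\<in>set g. x < 2 * k + 2 * t" "length (filter (\<lambda>x. x < 2 * k) g) \<ge> 4"
      "g ! 0 \<noteq> g ! 2" "g ! 1 \<noteq> g ! 3"
      using chk g unfolding incomplete_check_def list_all_iff by blast+
    obtain a b c d r where abc: "g = [a, b, c, d, r]"
      using c(1) by (auto simp: length_Suc_conv numeral_eq_Suc)
    have all5: "(\<forall>i<5. P i) \<longleftrightarrow> P 0 \<and> P 1 \<and> P 2 \<and> P 3 \<and> P 4" for P :: "nat \<Rightarrow> bool"
      by (auto simp: numeral_eq_Suc less_Suc_eq)
    show ?thesis using c(2-5) unfolding ok_def all5 abc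
      by (auto simp: swap_teams_def split: if_splits)
  qed
  have okB': "ok g" if "g \<in> set B'" for g using that okB by (auto simp: B'_def)
  have swB': "swap_teams g \<in> set B'" if "g \<in> set B'" for g using that okB by (auto simp: B'_def)
  have col_col: "col l (m - s) (col l s w) = w" if "s < m" for l s w
    unfolding col_def act_add using that by (simp add: act_period)
  have col_same: "col 0 = col 2" "col 1 = col 3" by (auto simp: col_def)
  have okG: "ok g \<and> swap_teams g \<in> G" if "g \<in> G" for g
  proof -
    from that obtain s g0 where g0: "s < m" "g0 \<in> set B'" "g = shift s g0" by (auto simp: G_def)
    note o = okB'[OF g0(2)]
    have nth: "g ! i = col i s (g0 ! i)" if "i < 5" for i using shift_nth[OF that] g0(3) by simp
    have "g ! 0 \<noteq> g ! 2"
    proof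
      assume "g ! 0 = g ! 2"
      then have "col 0 s (g0 ! 0) = col 0 s (g0 ! 2)" using nth[of 0] nth[of 2] col_same by simp
      then have "g0 ! 0 = g0 ! 2" using col_col[OF g0(1), of 0] by metis
      then show False using o by (simp add: ok_def)
    qed
    moreover have "g ! 1 \<noteq> g ! 3"
    proof
      assume "g ! 1 = g ! 3"
      then have "col 1 s (g0 ! 1) = col 1 s (g0 ! 3)" using nth[of 1] nth[of 3] col_same by simp
      then have "g0 ! 1 = g0 ! 3" using col_col[OF g0(1), of 1] by metis
      then show False using o by (simp add: ok_def)
    qed
    moreover have "g ! i \<in> X" if "i < 5" for i
      unfolding nth[OF that] by (rule col_lt) (use o that in \<open>simp add: ok_def\<close>)
    moreover have "g ! i < 2 * k \<or> g ! j < 2 * k" if "i < 5" "j < 5" "i \<noteq> j" for i j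
    proof -
      have "g0 ! i < 2 * k \<or> g0 ! j < 2 * k" using o that unfolding ok_def by blast
      then show ?thesis unfolding nth[OF that(1)] nth[OF that(2)] col_def act_finite .
    qed
    moreover have "length g = 5" using length_shift g0(3) by simp
    moreover have "swap_teams g \<in> G"
      unfolding g0(3) G_def using swap_shift[of g0 s] o swB'[OF g0(2)] g0(1) unfolding ok_def by blast
    ultimately show ?thesis unfolding ok_def by blast
  qed
  have ex1_mixed: "\<exists>!g. g \<in> G \<and> g ! i = x \<and> g ! j = y"
    if ij: "(i, j) \<in> set mixed_column_pairs" and xy: "x \<in> X" "y \<in> X" "x < 2 * k \<or> y < 2 * k" for i j x y
  proof (rule ex1_columns[where T = "\<lambda>x y. x < 2 * k \<or> y < 2 * k"])
    show ij5: "i < 5" "j < 5" "i \<noteq> j" using ij by (auto simp: mixed_column_pairs_def)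
    show "card {(x, y). x \<in> X \<and> y \<in> X \<and> (x < 2 * k \<or> y < 2 * k)} = m * length B'"
      using chk card_not_both_infinite by (simp add: incomplete_check_def B'_def mult_2)
    show "g ! i \<in> X \<and> g ! j \<in> X \<and> (g ! i < 2 * k \<or> g ! j < 2 * k)" if "g \<in> set B'" for g
      using okB'[OF that] ij5 unfolding ok_def by blast
    show "col i s x < 2 * k \<or> col j s y < 2 * k" if "x < 2 * k \<or> y < 2 * k" for x y s
      using that unfolding col_def act_finite .
    have "quick_distinct (map (\<lambda>g. case canon act k m i j (g ! i) (g ! j) of (x, y) \<Rightarrow> x * (2 * k + 2 * t) + y) B')"
      using chk ij unfolding incomplete_check_def Let_def B'_def list_all_iff by blast
    then have "distinct (map (\<lambda>g. case canon act k m i j (g ! i) (g ! j) of (x, y) \<Rightarrow> x * (2 * k + 2 * t) + y) B')"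
      by (rule quick_distinct_imp_distinct)
    then show "distinct (map (\<lambda>g. canon act k m i j (g ! i) (g ! j)) B')"
      by (auto simp: distinct_map inj_on_def)
  qed (use xy in simp_all)
  have ex1_G: "\<exists>!g. g \<in> G \<and> g ! i = x \<and> g ! j = y"
    if "i < 5" "j < 5" "i \<noteq> j" "\<not> same_sex i j" "x \<in> X" "y \<in> X" "x < 2 * k \<or> y < 2 * k" for i j x y
  proof (rule ex1_all_columns[OF _ that(1-3)])
    show "length g = 5 \<and> swap_teams g \<in> G" if "g \<in> G" for g using okG[OF that] unfolding ok_def by blast
    show "(\<exists>!g. g \<in> G \<and> g ! l = x \<and> g ! l' = y) \<and> (\<exists>!g. g \<in> G \<and> g ! l = y \<and> g ! l' = x)"
      if ll: "(l, l') \<in> {(0, 1), (0, 2), (0, 3), (0, 4), (1, 3), (1, 4)}" "same_sex l l' \<longleftrightarrow> same_sex i j" for l l'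
    proof -
      have "(l, l') \<in> set mixed_column_pairs"
        using ll \<open>\<not> same_sex i j\<close> by (auto simp: same_sex_cases mixed_column_pairs_def)
      then show ?thesis using ex1_mixed[of l l' x y] ex1_mixed[of l l' y x]
        \<open>x \<in> X\<close> \<open>y \<in> X\<close> \<open>x < 2 * k \<or> y < 2 * k\<close> by blast
    qed
  qed
  have ex_less: "\<exists>g\<in>G. g ! i = x \<and> g ! j = y"
    if ij: "(i, j) = (0, 2) \<or> (i, j) = (1, 3)" and xy: "x \<in> X" "y \<in> X" "x < 2 * k \<or> y < 2 * k" "x \<noteq> y" for i j x y
  proof -
    \<comment> \<open>Moves the pivot to residue 0, where the check applies;
      \<open>canon_col\<close> brings the result back to \<open>(x, y)\<close>.\<close>
    define s where "s = m - (if x < 2 * k then x else y) mod m"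
    define x' y' where "x' = col i s x" and "y' = col j s y"
    have X': "x' \<in> X" "y' \<in> X" unfolding x'_def y'_def by (rule col_lt, fact)+
    have fin: "x' < 2 * k \<longleftrightarrow> x < 2 * k" "y' < 2 * k \<longleftrightarrow> y < 2 * k"
      unfolding x'_def y'_def col_def act_finite by (rule refl)+
    have z: "(z + (m - z mod m)) mod m = 0" for z
    proof -
      have "z mod m + (m - z mod m) = m" using m_pos by (simp add: less_imp_le)
      then show ?thesis by (metis mod_add_left_eq mod_self)
    qed
    have pivot: "(if x' < 2 * k then x' else y') mod m = 0"
      using xy(3) act_mod[of x "i = 4" s] act_mod[of y "j = 4" s] z[of x] z[of y] fin
      unfolding s_def x'_def y'_def col_def by (cases "x < 2 * k") simp_all
    have "s \<le> m" by (simp add: s_def)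
    then have "col l (m - s) (col l s w) = w" for l w
      unfolding col_def act_add by (simp add: act_period)
    then have "x' \<noteq> y'" using ij xy(4) col_same unfolding x'_def y'_def by (metis prod.inject)
    then have "(i, j) \<in> set [(0, 2), (1, 3)]" "x' \<in> set [0..<2 * k + 2 * t]"
      "y' \<in> set (filter (\<lambda>y. x' \<noteq> y \<and> (x' < 2 * k \<or> y < 2 * k) \<and> (if x' < 2 * k then x' else y) mod m = 0)
        [0..<2 * k + 2 * t])"
      using ij xy(3) X' fin pivot by auto
    then have "canon act k m i j x' y' \<in> set (map (\<lambda>g. canon act k m i j (g ! i) (g ! j)) B')"
      using chk unfolding incomplete_check_def Let_def B'_def list_all_iff List.member_iff by blast
    then have "canon act k m i j x y \<in> set (map (\<lambda>g. canon act k m i j (g ! i) (g ! j)) B')"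
      using canon_col[OF xy(1-3)] by (simp only: x'_def y'_def)
    then obtain g where "g \<in> set B'" "canon act k m i j x y = canon act k m i j (g ! i) (g ! j)" by auto
    then show ?thesis using ex_of_canon_eq[of g i j x y] ij by auto
  qed
  have ex_G: "\<exists>g\<in>G. g ! i = x \<and> g ! j = y"
    if ss: "same_sex i j" and xy: "x \<in> X" "y \<in> X" "x < 2 * k \<or> y < 2 * k" "x \<noteq> y" for i j x y
  proof -
    consider "(i, j) = (0, 2) \<or> (i, j) = (1, 3)" | "(j, i) = (0, 2) \<or> (j, i) = (1, 3)"
      using ss unfolding same_sex_cases by blast
    then show ?thesis
    proof cases
      case 1
      then show ?thesis by (rule ex_less[OF _ xy])
    next
      case 2
      then have "\<exists>g\<in>G. g ! j = y \<and> g ! i = x" by (rule ex_less[OF _ xy(2,1)]) (use xy in blast)+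
      then show ?thesis by blast
    qed
  qed
  have RD: "length g = 5" "set g \<subseteq> X" "g ! 0 \<noteq> g ! 2" "g ! 1 \<noteq> g ! 3" "swap_teams g \<in> R"
    "\<And>i. i < 5 \<Longrightarrow> \<not> g ! i < 2 * k" if "g \<in> R" for g
  proof -
    note d = scheduleD[OF R that]
    show "length g = 5" "g ! 0 \<noteq> g ! 2" "g ! 1 \<noteq> g ! 3" "swap_teams g \<in> R" by (fact d)+
    show "set g \<subseteq> X" using d(6) by (auto simp: J_def)
    show "\<not> g ! i < 2 * k" if "i < 5" for i using d(2)[OF that] by (simp add: J_def)
  qed
  have notboth: "g \<notin> G" if "\<not> g ! i < 2 * k" "\<not> g ! j < 2 * k" "i < 5" "j < 5" "i \<noteq> j" for g i j
    using okG[of g] that unfolding ok_def by blast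
  have "schedule X (G \<union> R)"
  proof (rule scheduleI)
    fix g assume "g \<in> G \<union> R"
    then show "length g = 5 \<and> set g \<subseteq> X \<and> g ! 0 \<noteq> g ! 2 \<and> g ! 1 \<noteq> g ! 3 \<and> swap_teams g \<in> G \<union> R"
    proof
      assume "g \<in> G"
      then have "ok g" "swap_teams g \<in> G" using okG by blast+
      moreover have "set g \<subseteq> X" using \<open>ok g\<close> unfolding ok_def by (metis in_set_conv_nth subsetI)
      ultimately show ?thesis unfolding ok_def by blast
    qed (use RD in blast)
  next
    fix i j x y assume ij: "i < (5::nat)" "j < 5" "i \<noteq> j" "same_sex i j" and xy: "x \<in> X" "y \<in> X" "x \<noteq> y"
    show "\<exists>g\<in>G \<union> R. g ! i = x \<and> g ! j = y"
    proof (cases "x < 2 * k \<or> y < 2 * k")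
      case True
      then show ?thesis using ex_G[OF ij(4) xy(1,2) True xy(3)] by blast
    next
      case False
      then have "x \<in> J" "y \<in> J" using xy by (auto simp: J_def)
      then show ?thesis using schedule_ex[OF R ij(1-3) _ _ xy(3)] by blast
    qed
  next
    fix i j x y assume ij: "i < (5::nat)" "j < 5" "i \<noteq> j" "\<not> same_sex i j" and xy: "x \<in> X" "y \<in> X"
    show "\<exists>!g. g \<in> G \<union> R \<and> g ! i = x \<and> g ! j = y"
    proof (cases "x < 2 * k \<or> y < 2 * k")
      case True
      have "g \<in> G \<union> R \<and> g ! i = x \<and> g ! j = y \<longleftrightarrow> g \<in> G \<and> g ! i = x \<and> g ! j = y" for g
        using RD(6)[of g i] RD(6)[of g j] ij True by blast
      then show ?thesis using ex1_G[OF ij xy True] by simp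
    next
      case False
      then have J: "x \<in> J" "y \<in> J" using xy by (auto simp: J_def)
      have "g \<in> G \<union> R \<and> g ! i = x \<and> g ! j = y \<longleftrightarrow> g \<in> R \<and> g ! i = x \<and> g ! j = y" for g
        using notboth[of g i j] ij False by blast
      then show ?thesis using schedule_ex1[OF R ij J] by simp
    qed
  qed
  then show ?thesis by (auto simp: realizable_def distrib_left)
qed

section \<open>From schedules to tournaments\<close>

text \<open>A game arises from two rows, one for each order of its teams. Uniqueness of games
  follows from uniqueness of rows once the row is chosen in which a prescribed team comes first;
  \<open>team\<close> provides that row.\<close>

lemma tournament_of_schedule:
  assumes G: "schedule {0..<N} G" and N: "even N"
  shows "\<exists>S. strict_MMDRR N S \<and> fully_resolvable N S"
proof -
  define X where "X = {0..<N}"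
  have G: "schedule X G" using G by (simp add: X_def)
  define game where "game g = {(g ! 0, g ! 1), (g ! 2, g ! 3)}" for g :: "nat list"
  define S where "S = game ` G"
  define Rd where "Rd r = game ` {g \<in> G. g ! 4 = r}" for r
  note D = scheduleD[OF G]
  have uniq: "g = h" if "g \<in> G" "h \<in> G" "i < 5" "j < 5" "i \<noteq> j" "\<not> same_sex i j" "g ! i = h ! i" "g ! j = h ! j" for g h i j
    using schedule_ex1[OF G that(3-6) D(2)[OF that(2,3)] D(2)[OF that(2,4)]] that by blast
  have get: "\<exists>g\<in>G. g ! i = x \<and> g ! j = y"
    if "i < 5" "j < 5" "i \<noteq> j" "\<not> same_sex i j" "x < N" "y < N" for i j x y
    using schedule_ex1[OF G that(1-4), of x y] that(5,6) by (auto simp: X_def)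
  have nss: "\<not> same_sex 0 1" "\<not> same_sex 0 3" "\<not> same_sex 0 4" "\<not> same_sex 1 4"
    by (simp_all add: same_sex_cases)
  have swap: "swap_teams g ! 0 = g ! 2" "swap_teams g ! 1 = g ! 3" "swap_teams g ! 2 = g ! 0"
    "swap_teams g ! 3 = g ! 1" "swap_teams g ! 4 = g ! 4" "game (swap_teams g) = game g" for g :: "nat list"
    by (auto simp: swap_teams_def game_def)
  have team: "\<exists>g'\<in>G. game g' = game g \<and> g' ! 4 = g ! 4 \<and> g' ! 0 = a \<and> g' ! 1 = b"
    if "g \<in> G" "(a, b) \<in> game g" for g a b
  proof (cases "a = g ! 0 \<and> b = g ! 1")
    case False
    then have "a = g ! 2" "b = g ! 3" using that(2) by (auto simp: game_def)
    then show ?thesis using D(5)[OF that(1)] swap[of g] by blast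
  qed (use that(1) in blast)
  have lt: "g ! i < N" if "g \<in> G" "i < 5" for g i using D(2)[OF that] by (simp add: X_def)
  have finG: "finite G"
  proof (rule finite_subset)
    show "G \<subseteq> {g. set g \<subseteq> X \<and> length g = 5}" using D by blast
    show "finite {g. set g \<subseteq> X \<and> length g = 5}" by (rule finite_lists_length_eq) (simp add: X_def)
  qed
  have one: "card A = 1" if "A = {h}" for A :: "game set" and h using that by simp
  have strict: "strict_MMDRR N S" unfolding strict_MMDRR_def
  proof (intro conjI ballI allI impI)
    show "finite S" using finG by (simp add: S_def)
  next
    fix h assume "h \<in> S"
    then obtain g where g: "g \<in> G" "h = game g" by (auto simp: S_def)
    show "is_game N h" unfolding is_game_def g(2) game_def
      using lt[OF g(1), of 0] lt[OF g(1), of 1] lt[OF g(1), of 2] lt[OF g(1), of 3] D(3,4)[OF g(1)]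
      by (intro exI[of _ "g ! 0"] exI[of _ "g ! 1"] exI[of _ "g ! 2"] exI[of _ "g ! 3"]) simp
  next
    fix a b assume ab: "a < N" "b < N"
    then obtain g where g: "g \<in> G" "g ! 0 = a" "g ! 1 = b" using get[of 0 1 a b] nss(1) by auto
    have "h = game g" if hS: "h \<in> S" "partners h a b" for h
    proof -
      obtain g0 where g0: "g0 \<in> G" "h = game g0" using hS(1) by (auto simp: S_def)
      then obtain g' where g': "g' \<in> G" "game g' = h" "g' ! 0 = a" "g' ! 1 = b"
        using team[OF g0(1), of a b] hS(2) by (auto simp: partners_def)
      then show ?thesis using uniq[OF g'(1) g(1), of 0 1] nss(1) g by simp
    qed
    moreover have "partners (game g) a b" using g by (simp add: partners_def game_def)
    ultimately have "{h \<in> S. partners h a b} = {game g}" using g(1) by (auto simp: S_def)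
    then show "card {h \<in> S. partners h a b} = 1" by (rule one)
  next
    fix a b assume ab: "a < N" "b < N"
    then obtain g where g: "g \<in> G" "g ! 0 = a" "g ! 3 = b" using get[of 0 3 a b] nss(2) by auto
    have "h = game g" if hS: "h \<in> S" "oppose_mw h a b" for h
    proof -
      obtain x y where xy: "(a, x) \<in> h" "(y, b) \<in> h" "(a, x) \<noteq> (y, b)"
        using hS(2) by (auto simp: oppose_mw_def)
      obtain g0 where g0: "g0 \<in> G" "h = game g0" using hS(1) by (auto simp: S_def)
      obtain g' where g': "g' \<in> G" "game g' = h" "g' ! 0 = a" "g' ! 1 = x"
        using team[OF g0(1), of a x] xy(1) g0(2) by auto
      \<comment> \<open>The team \<open>(y, b)\<close> differs from the first team
        \<open>(a, x)\<close> of the row, so it is the second one.\<close>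
      have "g' ! 3 = b" using xy(2,3) g' by (auto simp: game_def)
      then show ?thesis using uniq[OF g'(1) g(1), of 0 3] nss(2) g g' by simp
    qed
    moreover have "oppose_mw (game g) a b" unfolding oppose_mw_def
      using D(3)[OF g(1)] g by (intro exI[of _ "g ! 1"] exI[of _ "g ! 2"]) (auto simp: game_def)
    ultimately have "{h \<in> S. oppose_mw h a b} = {game g}" using g(1) by (auto simp: S_def)
    then show "card {h \<in> S. oppose_mw h a b} = 1" by (rule one)
  next
    fix a c assume "a < N" "c < N" "a \<noteq> c"
    then obtain g where "g \<in> G" "g ! 0 = a" "g ! 2 = c" using schedule_ex[OF G, of 0 2 a c] by (auto simp: X_def)
    then show "\<exists>g\<in>S. oppose_mm g a c" using \<open>a \<noteq> c\<close>
      by (intro bexI[of _ "game g"]) (auto simp: oppose_mm_def man_plays_def game_def S_def)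
  next
    fix b d assume "b < N" "d < N" "b \<noteq> d"
    then obtain g where "g \<in> G" "g ! 1 = b" "g ! 3 = d" using schedule_ex[OF G, of 1 3 b d] by (auto simp: X_def)
    then show "\<exists>g\<in>S. oppose_ww g b d" using \<open>b \<noteq> d\<close>
      by (intro bexI[of _ "game g"]) (auto simp: oppose_ww_def woman_plays_def game_def S_def)
  qed
  have man: "\<exists>g\<in>G. game g = h \<and> g ! 0 = a \<and> g ! 4 = r" if hR: "h \<in> Rd r" "man_plays h a" for h a r
  proof -
    obtain g0 x where "g0 \<in> G" "h = game g0" "g0 ! 4 = r" "(a, x) \<in> h"
      using hR by (auto simp: Rd_def man_plays_def)
    then show ?thesis using team[of g0 a x] by auto
  qed
  have woman: "\<exists>g\<in>G. game g = h \<and> g ! 1 = b \<and> g ! 4 = r" if hR: "h \<in> Rd r" "woman_plays h b" for h b r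
  proof -
    obtain g0 x where "g0 \<in> G" "h = game g0" "g0 ! 4 = r" "(x, b) \<in> h"
      using hR by (auto simp: Rd_def woman_plays_def)
    then show ?thesis using team[of g0 x b] by auto
  qed
  have rounds: "is_round (Rd r)" for r unfolding is_round_def
  proof (intro ballI impI conjI allI notI)
    fix g h a assume gh: "g \<in> Rd r" "h \<in> Rd r" "g \<noteq> h" and a: "man_plays g a \<and> man_plays h a"
    obtain g' h' where "g' \<in> G" "game g' = g" "g' ! 0 = a" "g' ! 4 = r"
      "h' \<in> G" "game h' = h" "h' ! 0 = a" "h' ! 4 = r" using man gh a by metis
    then show False using uniq[of g' h' 0 4] nss(3) gh(3) by auto
  next
    fix g h b assume gh: "g \<in> Rd r" "h \<in> Rd r" "g \<noteq> h" and b: "woman_plays g b \<and> woman_plays h b"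
    obtain g' h' where "g' \<in> G" "game g' = g" "g' ! 1 = b" "g' ! 4 = r"
      "h' \<in> G" "game h' = h" "h' ! 1 = b" "h' ! 4 = r" using woman gh b by metis
    then show False using uniq[of g' h' 1 4] nss(4) gh(3) by auto
  qed
  have full: "full_round N (Rd r)" if "r < N" for r
  proof -
    have "\<exists>h\<in>Rd r. man_plays h a" if a: "a < N" for a
    proof -
      obtain g where "g \<in> G" "g ! 0 = a" "g ! 4 = r" using get[of 0 4 a r] nss(3) a \<open>r < N\<close> by auto
      then show ?thesis by (intro bexI[of _ "game g"]) (auto simp: Rd_def man_plays_def game_def)
    qed
    then have "{a. a < N \<and> (\<exists>h\<in>Rd r. man_plays h a)} = {..<N}" by auto
    moreover have "\<exists>h\<in>Rd r. woman_plays h b" if b: "b < N" for b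
    proof -
      obtain g where "g \<in> G" "g ! 1 = b" "g ! 4 = r" using get[of 1 4 b r] nss(4) b \<open>r < N\<close> by auto
      then show ?thesis by (intro bexI[of _ "game g"]) (auto simp: Rd_def woman_plays_def game_def)
    qed
    then have "{b. b < N \<and> (\<exists>h\<in>Rd r. woman_plays h b)} = {..<N}" by auto
    ultimately show ?thesis using N by (simp add: full_round_def players_in_def)
  qed
  have same_round: "r = r'" if hR: "h \<in> Rd r" "h \<in> Rd r'" for h r r'
  proof -
    obtain g where g: "g \<in> G" "h = game g" "g ! 4 = r" using hR by (auto simp: Rd_def)
    obtain g0 where g0: "g0 \<in> G" "h = game g0" "g0 ! 4 = r'" using hR by (auto simp: Rd_def)
    have "(g ! 0, g ! 1) \<in> game g0" using g(2) g0(2) by (auto simp: game_def)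
    then obtain g' where "g' \<in> G" "g' ! 4 = r'" "g' ! 0 = g ! 0" "g' ! 1 = g ! 1"
      using team[OF g0(1)] g0(3) by blast
    then show ?thesis using uniq[OF _ g(1), of g' 0 1] nss(1) g(3) by auto
  qed
  have "fully_resolvable N S" unfolding fully_resolvable_def
  proof (intro exI[of _ "Rd ` X"] conjI)
    show "partition_on S (Rd ` X)"
    proof (rule partition_onI)
      show "\<Union>(Rd ` X) = S" using D(2) unfolding Rd_def S_def by fastforce
      show "disjnt p q" if pq: "p \<in> Rd ` X" "q \<in> Rd ` X" "p \<noteq> q" for p q
        using pq same_round unfolding disjnt_def by blast
      have "p \<noteq> {}" if p: "p \<in> Rd ` X" for p
      proof -
        obtain r where r: "r < N" "p = Rd r" using p by (auto simp: X_def)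
        \<comment> \<open>Man 0 plays in every round.\<close>
        then obtain g where "g \<in> G" "g ! 4 = r" using get[of 0 4 0 r] nss(3) by auto
        then show ?thesis using r(2) unfolding Rd_def by blast
      qed
      then show "{} \<notin> Rd ` X" by blast
    qed
    show "\<forall>R\<in>Rd ` X. is_round R" using rounds by blast
    have "{R \<in> Rd ` X. \<not> full_round N R} = {}" using full by (auto simp: X_def)
    then show "card {R \<in> Rd ` X. \<not> full_round N R} \<le> 1" by (simp only: card.empty le0)
  qed
  then show ?thesis using strict by blast
qed

section \<open>Base games for the directly constructed orders\<close>

text \<open>The rounds 0 to 4 and 5 to 9 are the two orbits. The four games ending in 0 are the
  whole of round 0, in which only the points of the hole 0, 5 are idle; the other four make up round
  5.\<close>

lemma check_5: "base_check (block_act 5 5) 5 0 5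
    [[1,7,4,3,0],[2,4,3,6,0],[6,2,9,8,0],[7,9,8,1,0],[1,8,9,7,5],[2,6,8,9,5],[3,4,7,1,5],
     [4,2,6,3,5]]"
  by code_simp

lemma frame_5: "\<exists>F. frame {0..<2 * 5 + 2 * 0} (hole 5) F"
  using base_games.frame_of_base_check[OF base_games_block_act check_5] by simp

lemma realizable_5: "realizable 5"
  using frame_5 realizable_of_frame[OF _ _ realizable_0, of 5] by fastforce

lemma uniform_frame_5: "uniform_frame 5"
  using frame_5 uniform_frame_of_frame[of 5 0] by fastforce

text \<open>The points 10 and 11 are fixed. The last two games belong to the infinite rounds; their
  opponents come from different segments, so that five shifts engage all ten finite players of
  either sex.\<close>

lemma check_6: "base_check (block_act 5 5) 5 1 5
    [[1,3,11,7,0],[2,9,6,10,0],[3,2,4,11,0],[7,4,8,1,0],[9,6,10,8,0],[1,7,4,8,5],[2,3,10,4,5],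
     [3,10,6,2,5],[7,6,9,11,5],[8,9,11,1,5],[0,8,7,1,10],[0,3,6,9,11]]"
  by code_simp

lemma frame_6: "\<exists>F. frame {0..<2 * 5 + 2 * 1} (hole 5) F"
  using base_games.frame_of_base_check[OF base_games_block_act check_6] by simp

lemma realizable_6: "realizable 6"
  using frame_6 realizable_of_frame[OF _ _ realizable_1, of 5] by fastforce

lemma uniform_frame_6: "uniform_frame 6"
  using frame_6 uniform_frame_of_frame[of 5 1] by fastforce

lemma check_7: "base_check (block_act 7 7) 7 0 7
    [[1,6,5,10,0],[2,5,3,13,0],[4,3,6,12,0],[8,4,13,9,0],[9,1,12,11,0],[10,8,11,2,0],[1,3,9,4,7],
     [2,6,11,1,7],[3,12,13,8,7],[4,5,8,2,7],[5,13,10,11,7],[6,10,12,9,7]]"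
  by code_simp

lemma frame_7: "\<exists>F. frame {0..<2 * 7 + 2 * 0} (hole 7) F"
  using base_games.frame_of_base_check[OF base_games_block_act check_7] by simp

lemma realizable_7: "realizable 7"
  using frame_7 realizable_of_frame[OF _ _ realizable_0, of 7] by fastforce

lemma uniform_frame_7: "uniform_frame 7"
  using frame_7 uniform_frame_of_frame[of 7 0] by fastforce

lemma check_8: "base_check (block_act 7 7) 7 1 7
    [[1,11,10,14,0],[2,15,3,12,0],[4,2,6,3,0],[5,1,11,10,0],[8,9,15,13,0],[9,6,12,4,0],
     [13,8,14,5,0],[1,2,15,6,7],[2,13,5,11,7],[3,14,8,4,7],[4,3,12,8,7],[6,1,14,12,7],
     [9,15,10,5,7],[11,9,13,10,7],[0,12,10,4,14],[0,8,11,2,15]]"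
  by code_simp

lemma frame_8: "\<exists>F. frame {0..<2 * 7 + 2 * 1} (hole 7) F"
  using base_games.frame_of_base_check[OF base_games_block_act check_8] by simp

lemma realizable_8: "realizable 8"
  using frame_8 realizable_of_frame[OF _ _ realizable_1, of 7] by fastforce

lemma uniform_frame_8: "uniform_frame 8"
  using frame_8 uniform_frame_of_frame[of 7 1] by fastforce

lemma check_9: "base_check (block_act 9 9) 9 0 9
    [[1,2,8,7,0],[2,13,7,14,0],[3,5,6,4,0],[4,16,5,11,0],[10,6,17,3,0],[11,12,16,15,0],
     [12,17,15,10,0],[13,1,14,8,0],[1,4,16,14,9],[2,7,15,12,9],[3,11,10,8,9],[4,17,14,6,9],
     [5,10,13,3,9],[6,16,17,1,9],[7,2,12,15,9],[8,5,11,13,9]]"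
  by code_simp

lemma frame_9: "\<exists>F. frame {0..<2 * 9 + 2 * 0} (hole 9) F"
  using base_games.frame_of_base_check[OF base_games_block_act check_9] by simp

lemma realizable_9: "realizable 9"
  using frame_9 realizable_of_frame[OF _ _ realizable_0, of 9] by fastforce

lemma uniform_frame_9: "uniform_frame 9"
  using frame_9 uniform_frame_of_frame[of 9 0] by fastforce

lemma check_10: "base_check (block_act 9 9) 9 1 9
    [[1,7,8,2,0],[2,18,10,6,0],[3,16,6,11,0],[4,12,5,15,0],[7,19,17,3,0],[11,1,16,8,0],
     [12,13,19,5,0],[13,17,14,10,0],[15,14,18,4,0],[1,12,14,8,9],[2,4,7,5,9],[3,2,18,17,9],
     [4,16,11,19,9],[5,11,16,18,9],[6,7,19,10,9],[8,15,13,1,9],[10,3,17,6,9],[12,14,15,13,9],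
     [0,4,12,15,18],[0,5,15,12,19]]"
  by code_simp

lemma realizable_10: "realizable 10"
  using base_games.frame_of_base_check[OF base_games_block_act check_10] realizable_of_frame[OF _ _ realizable_1, of 9] by fastforce

lemma check_11: "base_check (block_act 11 11) 11 0 11
    [[1,4,10,17,0],[2,21,9,3,0],[3,1,8,18,0],[4,5,7,13,0],[5,9,6,19,0],[12,20,13,8,0],
     [14,16,17,2,0],[15,14,19,10,0],[16,12,21,7,0],[18,6,20,15,0],[1,8,16,3,11],[2,17,19,20,11],
     [3,2,15,9,11],[4,10,20,1,11],[5,7,14,4,11],[6,18,13,16,11],[7,21,17,15,11],[8,13,21,14,11],
     [9,6,12,5,11],[10,19,18,12,11]]"
  by code_simp

lemma realizable_11: "realizable 11"
  using base_games.frame_of_base_check[OF base_games_block_act check_11] realizable_of_frame[OF _ _ realizable_0, of 11] by fastforce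

text \<open>The group has order 3 and eight orbits of finite points. Each of the rounds 0, 3, ...,
  21 represents an orbit and has 11 games, since one hole is idle.\<close>

lemma check_12: "base_check (block_act 12 3) 12 0 3
    [[1,7,21,4,0],[2,10,20,16,0],[3,18,17,23,0],[4,6,22,13,0],[5,15,18,21,0],[6,22,11,19,0],
     [7,17,10,3,0],[8,2,9,1,0],[13,9,14,8,0],[15,5,23,20,0],[16,11,19,14,0],[0,4,13,5,3],
     [1,23,18,9,3],[2,13,5,22,3],[4,8,14,0,3],[6,12,21,1,3],[7,14,20,17,3],[8,19,22,11,3],
     [9,18,12,7,3],[10,16,23,2,3],[11,10,19,20,3],[16,6,17,21,3],[0,15,7,20,6],[1,10,16,2,6],
     [2,0,21,7,6],[3,14,8,9,6],[4,13,11,5,6],[5,23,13,16,6],[9,4,10,8,6],[12,19,20,1,6],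
     [14,11,22,3,6],[15,17,19,12,6],[17,22,23,21,6],[0,8,5,2,9],[1,3,11,22,9],[2,1,18,11,9],
     [3,4,23,13,9],[4,20,19,18,9],[6,17,8,10,9],[7,16,17,12,9],[10,6,15,14,9],[12,5,16,19,9],
     [13,23,22,0,9],[14,7,20,15,9],[1,21,2,20,12],[3,17,11,8,12],[4,23,7,2,12],[5,11,15,6,12],
     [6,9,17,3,12],[8,4,14,22,12],[9,16,13,19,12],[10,1,16,18,12],[18,10,23,7,12],[19,5,22,15,12],
     [20,14,21,13,12],[0,19,21,6,15],[1,17,12,16,15],[2,12,16,20,15],[4,18,5,9,15],[6,21,13,11,15],
     [7,8,23,22,15],[8,5,19,2,15],[9,13,18,0,15],[10,23,20,7,15],[11,14,22,4,15],[14,1,17,10,15],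
     [0,7,8,13,18],[1,4,17,11,18],[2,23,10,15,18],[3,5,7,0,18],[4,14,13,22,18],[5,10,11,9,18],
     [9,19,14,12,18],[12,3,19,8,18],[15,2,20,21,18],[16,1,23,17,18],[21,16,22,20,18],[0,17,4,7,21],
     [1,11,10,12,21],[2,19,8,3,21],[3,2,22,18,21],[5,0,19,4,21],[6,23,14,13,21],[7,6,16,8,21],
     [11,1,15,16,21],[12,20,17,14,21],[13,15,23,10,21],[18,5,20,22,21]]"
  by code_simp

lemma realizable_12: "realizable 12"
  using base_games.frame_of_base_check[OF base_games_block_act check_12] realizable_of_frame[OF _ _ realizable_0, of 12] by fastforce

lemma check_13: "base_check (block_act 13 13) 13 0 13
    [[1,19,5,4,0],[2,12,3,18,0],[4,24,25,3,0],[6,10,9,15,0],[7,2,21,14,0],[8,6,24,16,0],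
     [10,21,17,1,0],[11,5,20,22,0],[12,20,23,9,0],[14,8,18,17,0],[15,25,16,11,0],[19,23,22,7,0],
     [1,6,20,12,13],[2,14,4,20,13],[3,5,21,10,13],[5,22,10,24,13],[6,16,12,21,13],[7,8,19,9,13],
     [8,11,18,1,13],[9,2,24,4,13],[11,7,15,3,13],[14,23,25,19,13],[16,17,23,18,13],
     [17,15,22,25,13]]"
  by code_simp

lemma realizable_13: "realizable 13"
  using base_games.frame_of_base_check[OF base_games_block_act check_13] realizable_of_frame[OF _ _ realizable_0, of 13] by fastforce

lemma check_14: "base_check (block_act 13 13) 13 1 13
    [[1,7,17,18,0],[2,16,11,23,0],[3,8,27,17,0],[4,1,23,20,0],[5,24,19,3,0],[6,27,14,2,0],
     [7,26,25,11,0],[8,15,20,10,0],[9,12,16,19,0],[10,5,26,22,0],[12,6,22,21,0],[15,4,24,9,0],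
     [18,25,21,14,0],[1,5,12,8,13],[2,23,24,26,13],[3,2,10,11,13],[4,15,9,24,13],[5,7,8,6,13],
     [6,22,7,17,13],[11,16,15,27,13],[14,10,25,3,13],[16,21,23,18,13],[17,19,22,20,13],
     [18,14,26,4,13],[19,12,20,1,13],[21,25,27,9,13],[0,17,24,3,26],[0,22,15,10,27]]"
  by code_simp

lemma realizable_14: "realizable 14"
  using base_games.frame_of_base_check[OF base_games_block_act check_14] realizable_of_frame[OF _ _ realizable_1, of 13] by fastforce

lemma check_15: "base_check (block_act 15 15) 15 0 15
    [[12,2,21,3,15],[3,28,24,27,15],[1,4,20,13,15],[14,26,25,17,15],[7,5,29,9,15],[8,25,16,21,15],
     [5,6,17,1,15],[10,24,28,29,15],[13,10,23,12,15],[2,20,22,18,15],[4,11,18,8,15],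
     [11,19,27,22,15],[6,14,19,7,15],[9,16,26,23,15],[5,4,10,26,0],[4,14,11,16,0],[9,11,6,19,0],
     [1,7,14,23,0],[12,1,3,29,0],[8,2,7,28,0],[13,9,2,21,0],[17,3,28,27,0],[21,12,24,18,0],
     [26,13,19,17,0],[18,10,27,20,0],[29,8,16,22,0],[25,6,20,24,0],[22,5,23,25,0]]"
  by code_simp

lemma realizable_15: "realizable 15"
  using base_games.frame_of_base_check[OF base_games_block_act check_15] realizable_of_frame[OF _ _ realizable_0, of 15] by fastforce

text \<open>One orbit of 32 points, hence one orbit of rounds: the 15 games form round 0 without the
  hole 0, 16.\<close>

lemma check_16: "base_check (cyclic_act 16) 16 0 (2 * 16)
    [[2,20,9,1,0],[30,12,7,15,0],[4,8,19,29,0],[28,24,29,19,0],[10,7,31,14,0],[22,9,17,18,0],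
     [24,5,27,22,0],[8,11,21,10,0],[15,13,1,3,0],[20,26,12,6,0],[18,27,14,21,0],[25,30,23,2,0],
     [11,31,5,17,0],[26,25,6,23,0],[13,4,3,28,0]]"
  by code_simp

lemma realizable_16: "realizable 16"
  using base_games.frame_of_base_check[OF base_games_cyclic_act check_16] realizable_of_frame[OF _ _ realizable_0, of 16] by fastforce

lemma check_17: "base_check (block_act 17 17) 17 0 17
    [[1,4,16,13,0],[2,8,15,9,0],[3,22,14,29,0],[4,25,13,26,0],[5,31,12,20,0],[6,18,11,33,0],
     [7,11,10,6,0],[8,7,9,10,0],[18,32,33,19,0],[19,28,32,23,0],[20,12,31,5,0],[21,3,30,14,0],
     [22,1,29,16,0],[23,21,28,30,0],[24,2,27,15,0],[25,24,26,27,0],[1,8,29,19,17],[2,11,27,33,17],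
     [3,5,19,24,17],[4,28,25,15,17],[5,25,20,1,17],[6,22,28,14,17],[7,30,21,10,17],[8,13,18,31,17],
     [9,4,33,20,17],[10,21,30,7,17],[11,29,23,3,17],[12,26,31,16,17],[13,23,26,2,17],
     [14,12,32,27,17],[15,6,24,18,17],[16,9,22,32,17]]"
  by code_simp

lemma realizable_17: "realizable 17"
  using base_games.frame_of_base_check[OF base_games_block_act check_17] realizable_of_frame[OF _ _ realizable_0, of 17] by fastforce

lemma check_18: "base_check (block_act 17 17) 17 1 17
    [[5,12,28,23,17],[12,5,23,28,17],[2,25,31,11,17],[15,26,20,6,17],[10,22,29,14,0],[7,29,22,3,0],
     [14,27,18,8,17],[3,24,33,9,17],[11,10,19,20,17],[6,7,32,31,17],[34,19,9,15,0],[35,32,8,2,0],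
     [34,1,21,30,17],[35,16,30,21,17],[25,34,1,13,0],[26,35,16,4,0],[13,34,27,33,17],
     [4,35,24,18,17],[0,32,18,14,34],[0,19,33,3,35],[22,14,29,3,17],[4,6,13,11,0],[23,5,28,12,0],
     [2,10,15,7,0],[3,16,14,1,0],[1,15,16,2,17],[19,8,32,9,0],[25,13,26,4,17],[7,32,10,19,17],
     [6,30,11,21,0],[5,23,12,28,0],[8,22,9,29,17],[21,18,30,33,0],[18,31,33,20,0],[24,26,27,25,0],
     [20,27,31,24,0]]"
  by code_simp

lemma realizable_18: "realizable 18"
  using base_games.frame_of_base_check[OF base_games_block_act check_18] realizable_of_frame[OF _ _ realizable_1, of 17] by fastforce

lemma check_19: "base_check (block_act 19 19) 19 0 19
    [[1,5,3,33,0],[2,22,7,16,0],[4,1,12,37,0],[5,6,15,32,0],[6,11,18,27,0],[8,31,9,7,0],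
     [10,34,16,4,0],[11,17,14,21,0],[13,29,17,9,0],[20,28,34,13,0],[21,3,28,24,0],[22,14,23,36,0],
     [24,26,37,8,0],[25,35,33,2,0],[26,25,29,15,0],[27,12,36,20,0],[30,23,32,10,0],[31,18,35,30,0],
     [1,14,28,5,19],[2,24,32,37,19],[3,36,29,27,19],[4,18,36,1,19],[5,13,26,6,19],[6,8,35,11,19],
     [7,3,25,16,19],[8,20,33,34,19],[9,12,24,7,19],[10,25,27,33,19],[11,2,23,17,19],
     [12,30,21,32,19],[13,23,37,22,19],[14,35,34,31,19],[15,28,31,21,19],[16,15,30,4,19],
     [17,10,20,9,19],[18,26,22,29,19]]"
  by code_simp

lemma realizable_19: "realizable 19"
  using base_games.frame_of_base_check[OF base_games_block_act check_19] realizable_of_frame[OF _ _ realizable_0, of 19] by fastforce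

text \<open>The first 20 games are round 0, with all 40 players of either sex. Each of the last five
  stands for a pair of infinite rounds; its two men have different parity, as have its two women, so
  the shifts belonging to either round of the pair reach all finite players.\<close>

lemma check_20: "incomplete_check (cyclic_act 15) 15 5 (2 * 15)
    [[30,23,10,13,0],[31,21,17,24,0],[32,22,15,8,0],[33,28,16,5,0],[34,9,7,20,0],[35,15,25,17,0],
     [36,19,5,1,0],[37,26,18,0,0],[38,6,13,14,0],[39,4,24,10,0],[20,30,14,16,0],[12,31,1,18,0],
     [23,32,27,2,0],[3,33,21,27,0],[26,34,4,25,0],[0,35,2,11,0],[19,36,9,7,0],[8,37,29,29,0],
     [6,38,22,3,0],[11,39,28,12,0],[0,29,1,16,30],[0,25,3,0,32],[0,10,5,25,34],[0,24,7,15,36],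
     [0,4,15,3,38]]"
  by code_simp

lemma realizable_20: "realizable 20"
  using base_games.realizable_of_incomplete_check[OF base_games_cyclic_act check_20 realizable_5] by simp

lemma check_21: "base_check (block_act 21 21) 21 0 21
    [[18,7,41,37,0],[3,14,22,26,0],[19,13,30,36,0],[2,8,33,27,0],[9,12,35,23,0],[12,9,28,40,0],
     [4,2,39,41,0],[17,19,24,22,0],[16,29,36,3,0],[5,34,27,18,0],[10,15,37,32,0],[11,6,26,31,0],
     [7,33,31,4,0],[14,30,32,17,0],[15,38,23,16,0],[6,25,40,5,0],[1,39,34,11,0],[20,24,29,10,0],
     [8,28,25,1,0],[13,35,38,20,0],[1,15,20,6,21],[5,1,16,20,21],[8,17,13,4,21],[10,9,11,12,21],
     [2,10,19,11,21],[9,23,12,40,21],[7,22,14,41,21],[4,35,17,28,21],[3,33,18,30,21],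
     [6,24,15,39,21],[23,36,40,27,21],[22,32,41,31,21],[27,26,36,37,21],[26,29,37,34,21],
     [24,38,39,25,21],[29,3,34,18,21],[31,2,32,19,21],[28,8,35,13,21],[30,5,33,16,21],
     [25,14,38,7,21]]"
  by code_simp

lemma realizable_21: "realizable 21"
  using base_games.frame_of_base_check[OF base_games_block_act check_21] realizable_of_frame[OF _ _ realizable_0, of 21] by fastforce

text \<open>Ten points at infinity leave a hole of size 10, which the schedule for
  \<open>n = 5\<close> fills.\<close>

lemma check_22: "base_check (cyclic_act 17) 17 5 (2 * 17)
    [[34,32,3,9,0],[35,1,24,19,0],[36,20,32,22,0],[37,21,20,31,0],[38,5,33,25,0],[39,10,11,7,0],
     [40,8,28,4,0],[41,23,30,11,0],[42,15,10,28,0],[43,16,26,24,0],[5,34,19,26,0],[13,35,9,29,0],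
     [7,36,18,3,0],[12,37,2,27,0],[22,38,6,14,0],[25,39,31,33,0],[16,40,14,18,0],[23,41,8,2,0],
     [21,42,29,30,0],[1,43,4,13,0],[27,6,15,12,0],[0,21,1,28,34],[0,3,5,4,36],[0,14,7,23,38],
     [0,12,9,31,40],[0,23,13,18,42]]"
  by code_simp

lemma realizable_22: "realizable 22"
  using base_games.frame_of_base_check[OF base_games_cyclic_act check_22] realizable_of_frame[OF _ _ realizable_5, of 17] by fastforce

lemma check_23: "base_check (block_act 23 23) 23 0 23
    [[1,29,15,9,0],[2,35,7,18,0],[3,41,22,4,0],[4,24,14,13,0],[5,3,8,25,0],[6,36,21,8,0],
     [9,31,20,12,0],[10,6,16,27,0],[11,2,13,32,0],[12,26,19,16,0],[17,1,18,39,0],[24,33,28,15,0],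
     [25,43,33,7,0],[26,30,38,22,0],[27,40,43,14,0],[29,37,30,21,0],[31,34,40,5,0],[32,44,45,20,0],
     [34,10,39,45,0],[35,28,37,19,0],[36,38,42,11,0],[41,42,44,17,0],[1,10,25,18,23],
     [2,20,27,13,23],[3,7,29,8,23],[4,17,31,3,23],[5,34,33,31,23],[6,14,35,16,23],[7,43,37,25,23],
     [8,11,39,6,23],[9,21,41,1,23],[10,45,43,39,23],[11,38,45,36,23],[12,5,24,9,23],
     [13,15,26,4,23],[14,40,28,27,23],[15,33,30,24,23],[16,22,32,12,23],[17,42,34,41,23],
     [18,19,36,2,23],[19,28,38,35,23],[20,44,40,32,23],[21,37,42,29,23],[22,30,44,26,23]]"
  by code_simp

lemma realizable_23: "realizable 23"
  using base_games.frame_of_base_check[OF base_games_block_act check_23] realizable_of_frame[OF _ _ realizable_0, of 23] by fastforce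

lemma check_24: "base_check (cyclic_act 24) 24 0 (2 * 24)
    [[12,43,15,16,0],[36,29,9,32,0],[40,17,5,22,0],[8,7,19,26,0],[20,38,45,37,0],[28,10,27,35,0],
     [34,30,1,47,0],[14,18,23,25,0],[18,12,35,3,0],[30,36,37,21,0],[46,33,17,20,0],[2,39,7,28,0],
     [32,6,16,42,0],[21,11,3,13,0],[43,31,29,41,0],[38,4,10,44,0],[44,9,4,15,0],[47,14,25,34,0],
     [39,19,33,5,0],[26,23,22,1,0],[41,46,31,2,0],[13,8,11,40,0],[42,27,6,45,0]]"
  by code_simp

lemma realizable_24: "realizable 24"
  using base_games.frame_of_base_check[OF base_games_cyclic_act check_24] realizable_of_frame[OF _ _ realizable_0, of 24] by fastforce

lemma check_27: "base_check (block_act 27 27) 27 0 27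
    [[1,22,48,24,0],[26,32,33,30,0],[6,4,37,23,0],[21,50,44,31,0],[14,11,47,12,0],[13,43,34,42,0],
     [3,7,39,17,0],[24,47,42,37,0],[17,9,29,18,0],[10,45,52,36,0],[7,10,35,6,0],[20,44,46,48,0],
     [19,5,51,26,0],[8,49,30,28,0],[2,14,53,21,0],[25,40,28,33,0],[11,20,36,8,0],[16,34,45,46,0],
     [22,1,38,15,0],[5,53,43,39,0],[4,3,41,25,0],[23,51,40,29,0],[18,2,32,13,0],[9,52,49,41,0],
     [15,16,50,19,0],[12,38,31,35,0],[25,18,2,36,27],[9,4,18,50,27],[8,22,19,32,27],
     [17,19,10,35,27],[11,26,16,28,27],[24,15,3,39,27],[20,25,7,29,27],[23,6,4,48,27],
     [14,21,13,33,27],[22,11,5,43,27],[26,16,1,38,27],[21,17,6,37,27],[12,20,15,34,27],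
     [42,24,39,30,27],[47,10,34,44,27],[49,1,32,53,27],[36,23,45,31,27],[35,2,46,52,27],
     [50,3,31,51,27],[33,7,48,47,27],[51,12,30,42,27],[52,8,29,46,27],[28,13,53,41,27],
     [41,5,40,49,27],[43,9,38,45,27],[44,14,37,40,27]]"
  by code_simp

lemma realizable_27: "realizable 27"
  using base_games.frame_of_base_check[OF base_games_block_act check_27] realizable_of_frame[OF _ _ realizable_0, of 27] by fastforce

lemma check_28: "base_check (cyclic_act 22) 22 6 (2 * 22)
    [[44,1,39,24,0],[45,17,26,12,0],[46,18,28,30,0],[47,29,11,43,0],[48,42,13,40,0],[49,32,8,36,0],
     [50,21,24,4,0],[51,8,20,16,0],[52,23,41,3,0],[53,15,40,33,0],[54,39,35,5,0],[55,35,36,7,0],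
     [38,44,2,25,0],[14,45,4,37,0],[10,46,30,11,0],[34,47,27,2,0],[43,48,3,13,0],[31,49,25,41,0],
     [9,50,6,26,0],[23,51,7,6,0],[18,52,32,27,0],[12,53,29,20,0],[1,54,16,14,0],[17,55,42,9,0],
     [19,28,21,34,0],[5,31,37,38,0],[33,10,15,19,0],[0,12,1,37,44],[0,3,5,2,46],[0,34,9,3,48],
     [0,31,11,16,50],[0,18,13,21,52],[0,17,21,28,54]]"
  by code_simp

lemma realizable_28: "realizable 28"
  using base_games.frame_of_base_check[OF base_games_cyclic_act check_28] realizable_of_frame[OF _ _ realizable_6, of 22] by fastforce

lemma check_29: "base_check (block_act 29 29) 29 0 29
    [[14,39,53,1,29],[15,48,34,28,29],[3,27,41,43,29],[26,2,46,44,29],[7,19,52,49,29],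
     [22,10,35,38,29],[28,22,40,54,29],[1,7,47,33,29],[4,47,57,23,29],[25,40,30,6,29],
     [2,52,54,17,29],[27,35,33,12,29],[23,16,55,30,29],[6,13,32,57,29],[16,18,56,51,29],
     [13,11,31,36,29],[11,50,44,3,29],[18,37,43,26,29],[9,32,45,20,29],[20,55,42,9,29],
     [5,21,48,42,29],[24,8,39,45,29],[8,53,36,14,29],[21,34,51,15,29],[19,46,50,24,29],
     [10,41,37,5,29],[12,4,49,31,29],[17,25,38,56,29],[2,1,27,28,0],[1,26,28,3,0],[3,6,26,23,0],
     [4,13,25,16,0],[9,19,20,10,0],[11,25,18,4,0],[7,18,22,11,0],[6,47,23,40,0],[5,52,24,35,0],
     [8,30,21,57,0],[10,36,19,51,0],[14,48,15,39,0],[13,43,16,44,0],[12,32,17,55,0],[36,21,51,8,0],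
     [35,15,52,14,0],[41,22,46,7,0],[38,27,49,2,0],[43,12,44,17,0],[37,9,50,20,0],[40,24,47,5,0],
     [39,49,48,38,0],[30,50,57,37,0],[33,46,54,41,0],[42,54,45,33,0],[32,31,55,56,0],
     [31,53,56,34,0],[34,42,53,45,0]]"
  by code_simp

lemma realizable_29: "realizable 29"
  using base_games.frame_of_base_check[OF base_games_block_act check_29] realizable_of_frame[OF _ _ realizable_0, of 29] by fastforce

lemma check_31: "base_check (block_act 31 31) 31 0 31
    [[8,16,56,12,0],[23,46,37,50,0],[16,29,50,3,31],[15,33,43,59,31],[1,17,59,4,31],
     [30,45,34,58,31],[20,14,39,6,31],[11,48,54,56,31],[25,21,51,22,31],[6,41,42,40,31],
     [29,2,38,13,31],[2,60,55,49,31],[22,28,60,11,0],[9,34,33,51,0],[17,7,35,23,0],[14,55,58,39,0],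
     [26,25,47,27,31],[5,37,46,35,31],[18,1,48,8,0],[13,61,45,54,0],[28,30,57,9,0],[3,32,36,53,0],
     [27,19,52,10,31],[4,43,41,52,31],[12,24,32,5,0],[19,38,61,57,0],[10,20,49,26,31],
     [21,42,44,36,31],[7,18,53,15,31],[24,44,40,47,31],[40,10,53,52,0],[8,28,23,34,31],
     [60,23,33,39,31],[39,20,54,42,0],[41,6,52,56,0],[32,24,61,38,31],[55,19,38,43,0],
     [35,1,58,61,31],[49,21,44,41,0],[51,29,42,33,0],[47,26,46,36,0],[45,30,48,32,31],
     [37,11,56,51,31],[57,12,36,50,31],[43,2,50,60,0],[59,27,34,35,0],[16,17,15,45,0],
     [17,5,14,57,31],[18,9,13,53,31],[12,7,19,55,31],[26,4,5,58,0],[6,3,25,59,0],[29,15,2,47,0],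
     [3,8,28,54,31],[7,22,24,40,0],[9,16,22,46,31],[10,13,21,49,0],[27,14,4,48,0],[1,25,30,37,0],
     [20,18,11,44,0]]"
  by code_simp

lemma realizable_31: "realizable 31"
  using base_games.frame_of_base_check[OF base_games_block_act check_31] realizable_of_frame[OF _ _ realizable_0, of 31] by fastforce

lemma check_32: "base_check (cyclic_act 32) 32 0 (2 * 32)
    [[60,16,35,63,0],[4,48,61,33,0],[38,51,7,62,0],[26,45,25,2,0],[50,28,53,57,0],[14,36,43,39,0],
     [34,5,55,6,0],[30,27,41,58,0],[24,54,5,29,0],[40,10,27,3,0],[54,49,45,44,0],[10,47,51,20,0],
     [20,18,47,9,0],[44,46,49,23,0],[48,11,63,56,0],[16,21,33,8,0],[31,19,1,13,0],[58,25,6,7,0],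
     [62,43,2,53,0],[23,15,9,17,0],[17,31,15,1,0],[36,61,28,35,0],[59,38,37,26,0],[46,55,18,41,0],
     [56,50,8,14,0],[19,30,13,34,0],[57,60,39,4,0],[21,37,11,59,0],[42,24,22,40,0],[52,42,12,22,0],
     [29,12,3,52,0]]"
  by code_simp

lemma realizable_32: "realizable 32"
  using base_games.frame_of_base_check[OF base_games_cyclic_act check_32] realizable_of_frame[OF _ _ realizable_0, of 32] by fastforce

lemma check_33: "base_check (block_act 33 33) 33 0 33
    [[32,31,62,52,0],[1,2,37,47,0],[14,57,36,28,33],[19,42,63,5,33],[31,10,55,35,0],[2,23,44,64,0],
     [24,41,34,25,0],[9,58,65,8,0],[6,14,58,40,0],[27,19,41,59,0],[15,30,64,39,0],[18,3,35,60,0],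
     [26,50,54,15,0],[7,49,45,18,0],[5,16,42,48,0],[28,17,57,51,0],[23,7,48,53,0],[10,26,51,46,0],
     [16,63,47,11,0],[17,36,52,22,0],[12,65,60,29,0],[21,34,39,4,0],[8,43,53,32,0],[25,56,46,1,0],
     [20,54,40,27,0],[13,45,59,6,0],[22,20,49,38,0],[11,13,50,61,0],[4,24,38,62,0],[29,9,61,37,0],
     [3,44,43,21,33],[30,55,56,12,33],[14,21,19,12,0],[36,55,63,44,0],[3,42,30,57,0],
     [43,5,56,28,0],[44,25,55,8,33],[45,16,54,17,33],[41,1,58,32,33],[46,3,53,30,33],
     [38,22,61,11,33],[39,7,60,26,33],[37,19,62,14,33],[5,24,28,9,33],[2,6,31,27,33],
     [6,15,27,18,33],[8,31,25,2,33],[7,13,26,20,33],[13,10,20,23,33],[1,29,32,4,33],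
     [15,36,18,63,33],[12,40,21,59,33],[4,34,29,65,33],[16,56,17,43,33],[9,46,24,53,33],
     [10,54,23,45,33],[11,62,22,37,33],[34,38,65,61,33],[42,35,57,64,33],[48,60,51,39,33],
     [35,51,64,48,33],[40,41,59,58,33],[47,49,52,50,33],[49,52,50,47,33]]"
  by code_simp

lemma realizable_33: "realizable 33"
  using base_games.frame_of_base_check[OF base_games_block_act check_33] realizable_of_frame[OF _ _ realizable_0, of 33] by fastforce

lemma check_34: "base_check (block_act 33 33) 33 1 33
    [[20,48,50,8,33],[13,51,49,25,33],[25,64,39,12,0],[8,35,60,21,0],[31,34,43,32,33],
     [2,65,56,1,33],[6,59,65,17,33],[27,40,34,16,33],[18,41,45,13,0],[15,58,54,20,0],
     [28,54,51,31,33],[5,45,48,2,33],[21,22,52,44,33],[12,11,47,55,33],[19,28,53,43,0],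
     [14,5,46,56,0],[4,23,61,50,33],[29,10,38,49,33],[3,9,41,38,33],[30,24,58,61,33],
     [23,19,40,60,0],[10,14,59,39,0],[22,15,37,36,33],[11,18,62,63,33],[26,3,55,37,33],
     [7,30,44,62,33],[66,6,63,42,0],[67,27,36,57,0],[66,46,1,29,33],[67,53,32,4,33],
     [42,66,17,52,0],[57,67,16,47,0],[24,66,35,7,33],[9,67,64,26,33],[0,54,53,8,66],
     [0,45,46,25,67],[14,58,19,41,33],[41,36,58,63,0],[2,34,31,65,0],[42,28,57,5,33],
     [36,13,63,20,33],[34,9,65,24,0],[39,43,60,56,33],[46,60,53,39,33],[35,51,64,48,0],
     [38,40,61,59,0],[47,17,52,16,0],[40,64,59,35,33],[43,37,56,62,0],[37,44,62,55,0],
     [45,14,54,19,33],[44,7,55,26,0],[49,23,50,10,0],[48,31,51,2,0],[3,15,30,18,0],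
     [15,52,18,47,33],[4,46,29,53,0],[7,54,26,45,0],[13,61,20,38,0],[1,50,32,49,0],
     [16,57,17,42,33],[10,21,23,12,33],[12,25,21,8,0],[6,3,27,30,0],[8,6,25,27,33],[9,1,24,32,0],
     [11,29,22,4,0],[5,22,28,11,0]]"
  by code_simp

lemma realizable_34: "realizable 34"
  using base_games.frame_of_base_check[OF base_games_block_act check_34] realizable_of_frame[OF _ _ realizable_1, of 33] by fastforce

lemma check_39: "base_check (block_act 39 39) 39 0 39
    [[7,15,45,5,0],[32,63,72,73,0],[6,28,73,12,0],[33,50,44,66,0],[8,24,62,10,0],[31,54,55,68,0],
     [25,18,41,21,0],[14,60,76,57,0],[29,1,56,9,0],[10,77,61,69,0],[28,2,77,29,39],
     [11,76,40,49,39],[2,17,43,32,39],[37,61,74,46,39],[30,3,66,38,39],[9,75,51,40,39],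
     [16,36,69,6,0],[23,42,48,72,0],[19,13,63,8,0],[20,65,54,70,0],[27,31,58,14,0],[12,47,59,64,0],
     [3,33,75,34,0],[36,45,42,44,0],[34,30,52,19,0],[5,48,65,59,0],[17,20,49,26,0],[22,58,68,52,0],
     [21,27,64,7,0],[18,51,53,71,0],[35,25,57,23,0],[4,53,60,55,0],[26,11,46,4,0],[13,67,71,74,0],
     [1,22,70,35,0],[38,56,47,43,0],[15,16,67,37,0],[24,62,50,41,0],[37,17,2,61,0],[77,32,40,46,0],
     [30,29,9,49,0],[11,3,28,75,0],[74,38,43,40,0],[66,2,51,76,0],[33,11,6,67,39],[41,12,76,66,39],
     [69,31,48,47,39],[15,1,24,77,39],[7,25,32,53,39],[3,10,36,68,39],[31,19,8,59,39],
     [13,23,26,55,39],[35,22,4,56,39],[22,27,17,51,39],[20,18,19,60,39],[5,7,34,71,39],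
     [14,9,25,69,39],[29,13,10,65,39],[38,8,1,70,39],[23,37,16,41,39],[27,16,12,62,39],
     [18,15,21,63,39],[71,5,46,73,39],[59,6,58,72,39],[49,28,68,50,39],[75,21,42,57,39],
     [55,4,62,74,39],[67,35,50,43,39],[56,30,61,48,39],[45,26,72,52,39],[70,33,47,45,39],
     [65,34,52,44,39],[53,36,64,42,39],[73,24,44,54,39],[60,14,57,64,39],[63,20,54,58,39]]"
  by code_simp

lemma realizable_39: "realizable 39"
  using base_games.frame_of_base_check[OF base_games_block_act check_39] realizable_of_frame[OF _ _ realizable_0, of 39] by fastforce

lemma realizable_direct:
  assumes "n \<in> set ([5..<25] @ [27, 28, 29, 31, 32, 33, 34, 39])"
  shows "realizable n"
proof -
  have "[5..<25] = [5, 6, 7, 8, 9, 10, 11, 12, 13, 14, 15, 16, 17, 18, 19, 20, 21, 22, 23, 24]" by simp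
  then have "n \<in> {5, 6, 7, 8, 9, 10, 11, 12, 13, 14, 15, 16, 17, 18, 19, 20, 21, 22, 23, 24, 27, 28, 29, 31, 32, 33, 34, 39}"
    using assms by (simp only: append.simps list.set)
  then show ?thesis
    by (elim insertE emptyE) (simp_all only: realizable_5 realizable_6 realizable_7 realizable_8 realizable_9 realizable_10 realizable_11 realizable_12 realizable_13 realizable_14 realizable_15 realizable_16 realizable_17 realizable_18 realizable_19 realizable_20 realizable_21 realizable_22 realizable_23 realizable_24 realizable_27 realizable_28 realizable_29 realizable_31 realizable_32 realizable_33 realizable_34 realizable_39)
qed

lemma uniform_frame_5_to_9:
  assumes "5 \<le> s" "s \<le> 9"
  shows "uniform_frame s"
proof -
  have "s \<in> {5, 6, 7, 8, 9}" using assms by simp linarith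
  then show ?thesis
    by (elim insertE emptyE)
      (simp_all only: uniform_frame_5 uniform_frame_6 uniform_frame_7 uniform_frame_8 uniform_frame_9)
qed

section \<open>Recursion for all orders\<close>

text \<open>A prime is coprime to all smaller positive numbers. At most four groups are truncated,
  because frames are at hand for blocks of size 5 to 9.\<close>

lemma realizable_td_prime:
  assumes m: "prime m" "realizable m" and ws: "\<And>w. w \<in> set ws \<Longrightarrow> w \<le> m \<and> realizable w"
    and len: "length ws \<le> 4" "4 + length ws \<le> m"
  shows "realizable (5 * m + sum_list ws)"
proof (rule realizable_td[OF m(2) _ ws])
  show "0 < m" using m(1) prime_gt_0_nat by blast
  show "coprime d m" if "0 < d" "d < 4 + length ws" for d
  proof -
    have "\<not> m dvd d" using that len(2) by (auto dest: dvd_imp_le)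
    then show ?thesis using prime_imp_coprime[OF m(1)] coprime_commute by blast
  qed
  show "uniform_frame s" if "5 \<le> s" "s \<le> 5 + length ws" for s
    using uniform_frame_5_to_9 that len(1) by simp
qed

text \<open>With a single truncated group only 1, 2, 3, 4 must be coprime to \<open>m\<close>, so
  \<open>m\<close> may be any number prime to 6; this keeps primes out of the unbounded part of the
  recursion.\<close>

lemma realizable_td_coprime_6:
  assumes m: "m mod 6 = 1 \<or> m mod 6 = 5" "realizable m" and w: "w \<le> m" "realizable w"
  shows "realizable (5 * m + w)"
proof -
  have "coprime d m" if "0 < d" "d < 5" for d
  proof -
    have 2: "coprime 2 m" using m(1) unfolding coprime_left_2_iff_odd by presburger
    have "\<not> 3 dvd m" using m(1) by presburger
    then have 3: "coprime 3 m" by (intro prime_imp_coprime) simp_all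
    have 4: "coprime 4 m" using 2 coprime_power_left_iff[of 2 2 m] by simp
    have "d = 1 \<or> d = 2 \<or> d = 3 \<or> d = 4" using that by linarith
    then show ?thesis using 2 3 4 by (elim disjE) simp_all
  qed
  moreover have "0 < m" using m(1) by (cases m) simp_all
  ultimately show ?thesis
    using realizable_td[of m "[w]"] m(2) w uniform_frame_5_to_9 by simp
qed

text \<open>The entry \<open>(m, ws)\<close> produces \<open>5 * m + sum_list ws\<close>. The orders
  from 25 to 129 without an entry are out of reach of such designs: below 55 one has
  \<open>m = 5\<close> with a single truncated group, giving 25, 26, 30, or \<open>m = 7\<close>
  with at most three. Truncations to 2, 3 or 4 being excluded, this leaves 27 to 29, 31 to 34, and
  39.\<close>

definition td_table :: "(nat \<times> nat list) list" where
  "td_table =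
    [(5,[0]),(5,[1]),(5,[5]),(7,[0]),(7,[1]),(7,[1,1]),(7,[1,1,1]),(7,[5]),(7,[6]),(7,[7]),
     (7,[1,7]),(7,[1,1,7]),(7,[5,5]),(7,[5,6]),(7,[5,7]),(7,[6,7]),(7,[7,7]),(7,[1,7,7]),
     (7,[5,5,6]),(7,[5,5,7]),(7,[5,6,7]),(7,[5,7,7]),(7,[6,7,7]),(7,[7,7,7]),(11,[1,1]),
     (11,[1,1,1]),(11,[1,1,1,1]),(11,[5]),(11,[6]),(11,[7]),(11,[8]),(11,[9]),(11,[10]),
     (11,[11]),(11,[1,11]),(11,[5,8]),(11,[5,9]),(11,[5,10]),(11,[5,11]),(11,[6,11]),(11,[7,11]),
     (11,[8,11]),(11,[9,11]),(11,[10,11]),(11,[11,11]),(11,[1,11,11]),(11,[5,8,11]),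
     (11,[5,9,11]),(11,[5,10,11]),(11,[5,11,11]),(11,[6,11,11]),(11,[7,11,11]),(11,[8,11,11]),
     (11,[9,11,11]),(11,[10,11,11]),(11,[11,11,11]),(11,[1,11,11,11]),(11,[5,8,11,11]),
     (11,[5,9,11,11]),(11,[5,10,11,11]),(11,[5,11,11,11]),(11,[6,11,11,11]),(11,[7,11,11,11]),
     (11,[8,11,11,11]),(11,[9,11,11,11]),(11,[10,11,11,11]),(11,[11,11,11,11]),(13,[9,13,13]),
     (13,[10,13,13]),(13,[11,13,13]),(13,[12,13,13]),(13,[13,13,13]),(13,[1,13,13,13]),
     (13,[5,10,13,13]),(13,[5,11,13,13]),(13,[5,12,13,13]),(13,[5,13,13,13]),(13,[6,13,13,13]),
     (13,[7,13,13,13]),(13,[8,13,13,13]),(13,[9,13,13,13]),(13,[10,13,13,13]),(13,[11,13,13,13]),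
     (13,[12,13,13,13]),(13,[13,13,13,13]),(17,[16,17]),(17,[17,17]),(17,[1,17,17]),
     (17,[5,14,17]),(17,[5,15,17]),(17,[5,16,17]),(17,[5,17,17]),(17,[6,17,17]),(17,[7,17,17]),
     (17,[8,17,17]),(17,[9,17,17]),(17,[10,17,17])]"

lemma td_table_covers:
  "list_all (\<lambda>n. List.member [27, 28, 29, 31, 32, 33, 34, 39] n \<or>
     list_ex (\<lambda>p. n = 5 * fst p + sum_list (snd p)) td_table) [25..<130]"
  unfolding td_table_def by code_simp

lemma td_table_valid:
  "list_all (\<lambda>p. List.member [5, 7, 11, 13, 17, 23] (fst p) \<and> length (snd p) \<le> 4 \<and>
     4 + length (snd p) \<le> fst p \<and> list_all (\<lambda>w. w \<le> fst p \<and> (w = 0 \<or> w = 1 \<or> 5 \<le> w)) (snd p)) td_table"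
  unfolding td_table_def by code_simp

text \<open>For large \<open>n\<close> one needs \<open>n = 5 * m + w\<close> with \<open>m\<close>
  prime to 6 and \<open>w\<close> between 5 and \<open>m\<close>. The values \<open>5 * m\<close>
  are 5 and 25 modulo 30, hence the division of \<open>n - 5\<close> by 30.\<close>

lemma realizable_ge_5: "5 \<le> n \<Longrightarrow> realizable n"
proof (induction n rule: less_induct)
  case (less n)
  have R: "realizable w" if "w = 0 \<or> w = 1 \<or> 5 \<le> w" "w < n" for w
    using that less.IH realizable_0 realizable_1 by auto
  consider "n \<le> 24" | "25 \<le> n" "n < 130" | "130 \<le> n" by linarith
  then show ?case
  proof cases
    case 1
    then have "n \<in> set [5..<25]" using less.prems unfolding set_upt atLeastLessThan_iff by linarith
    then show ?thesis by (intro realizable_direct) (simp only: set_append Un_iff simp_thms)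
  next
    case 2
    then have "n \<in> set [25..<130]" unfolding set_upt atLeastLessThan_iff by blast
    then have "List.member [27, 28, 29, 31, 32, 33, 34, 39] n \<or>
        (\<exists>p\<in>set td_table. n = 5 * fst p + sum_list (snd p))"
      using td_table_covers unfolding list_all_iff list_ex_iff by blast
    then show ?thesis
    proof
      assume "List.member [27, 28, 29, 31, 32, 33, 34, 39] n"
      then show ?thesis
        unfolding List.member_iff by (intro realizable_direct) (simp only: set_append Un_iff simp_thms)
    next
      assume "\<exists>p\<in>set td_table. n = 5 * fst p + sum_list (snd p)"
      then obtain m ws where mws: "(m, ws) \<in> set td_table" "n = 5 * m + sum_list ws" by auto
      then have v: "m \<in> {5, 7, 11, 13, 17, 23}" "length ws \<le> 4" "4 + length ws \<le> m"
        "\<And>w. w \<in> set ws \<Longrightarrow> w \<le> m \<and> (w = 0 \<or> w = 1 \<or> 5 \<le> w)"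
        using td_table_valid unfolding list_all_iff List.member_iff by fastforce+
      have m: "prime m" "5 \<le> m" using v(1) by (elim insertE emptyE; simp)+
      have "m < n" using m(2) mws(2) by linarith
      then have "realizable m" using R[of m] m(2) by simp
      moreover have "w \<le> m \<and> realizable w" if "w \<in> set ws" for w
      proof -
        have "w \<le> m" "w = 0 \<or> w = 1 \<or> 5 \<le> w" using v(4)[OF that] by blast+
        then show ?thesis using R[of w] \<open>m < n\<close> by simp
      qed
      ultimately show ?thesis unfolding mws(2) using m(1) v(2,3) by (intro realizable_td_prime) blast+
    qed
  next
    case 3
    define r s where "r = (n - 5) div 30" and "s = (n - 5) mod 30"
    have rs: "n = 30 * r + s + 5" "s < 30" "4 \<le> r" using 3 by (auto simp: r_def s_def)
    have step: "realizable n" if "m mod 6 = 1 \<or> m mod 6 = 5" "n = 5 * m + w" "5 \<le> w" "w \<le> m" for m w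
    proof -
      have "realizable m" "realizable w" using that(2-4) by (auto intro!: R)
      then show ?thesis unfolding that(2) using that(1,4) by (intro realizable_td_coprime_6)
    qed
    \<comment> \<open>The choices are \<open>m = 6 * r - 1\<close>, \<open>6 * r + 1\<close>,
      \<open>6 * r + 5\<close> with \<open>w = s + 10\<close>, \<open>s\<close>,
      \<open>s - 20\<close>. For \<open>s < 5\<close> the middle choice could give \<open>w\<close>
      equal to 2, 3 or 4. The largest \<open>w\<close> is 24, in the middle case, where
      \<open>m\<close> is at least 25 as \<open>r\<close> is at least 4.\<close>
    consider "s < 5" | "5 \<le> s" "s < 25" | "25 \<le> s" by linarith
    then show ?thesis
    proof cases
      case 1
      obtain p where p: "r = Suc p" using rs(3) by (cases r) simp_all
      show ?thesis
        by (rule step[of "6 * p + 5" "s + 10"]) (use 1 rs p in \<open>(simp; fail) | linarith\<close>)+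
    next
      case 2
      show ?thesis
        by (rule step[of "6 * r + 1" s]) (use 2 rs in \<open>(simp; fail) | linarith\<close>)+
    next
      case 3
      obtain p where p: "s = 25 + p" using 3 le_Suc_ex by blast
      show ?thesis
        by (rule step[of "6 * r + 5" "p + 5"]) (use rs p in \<open>(simp; fail) | linarith\<close>)+
    qed
  qed
qed

theorem theorem7:
  fixes n :: nat
  assumes "n \<ge> 5"
  shows "\<exists>S. strict_MMDRR (2 * n) S \<and> fully_resolvable (2 * n) S"
  using realizable_ge_5[OF assms] tournament_of_schedule[of "2 * n"] by (auto simp: realizable_def)

end
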